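(* Let $(G,c)$ be a network with reference vertex $o$, let $J:\operatorname{span}\{\delta_x\}_{x\in G}\subseteq\ell^2(G)\to\mathcal H_{\mathcal E}$ be the inclusion operator $J\delta_x=\delta_x$, and let $M:\operatorname{span}\{v_x\}_{x\in G}\subseteq\mathcal H_{\mathcal E}\to\ell^2(G)$ be the operator $(Mu)(x)=\langle\delta_x,u\rangle_{\mathcal H_{\mathcal E}}$. Then $\overline J=M^\star$ and $J^\star=\overline M$, where bars denote closures of operators and $\star$ denotes adjoints.
   Context: A network $(G,c)$ is a connected weighted undirected graph with vertex set $G$, given by a symmetric function $c:G\times G\to[0,\infty)$, $(x,y)\mapsto c_{xy}=c_{yx}$, with $c_{xx}=0$; write $x\sim y$ iff $c_{xy}>0$. It is locally finite (each $x$ has only finitely many $y$ with $y\sim x$) and connected (any two vertices are joined by a finite path of edges with positive conductance). A reference vertex $o\in G$ is fixed. The energy form is $\mathcal E(u,v)=\frac12\sum_{x,y\in G}c_{xy}(u(x)-u(y))(v(x)-v(y))$ on $\operatorname{dom}\mathcal E=\{u:G\to\mathbb R:\mathcal E(u,u)<\infty\}$. The energy space $\mathcal H_{\mathcal E}:=\operatorname{dom}\mathcal E/\mathbb R\mathbf 1$ (functions of finite energy modulo constants) is a Hilbert space with inner product $\langle u,v\rangle_{\mathcal H_{\mathcal E}}=\mathcal E(u,v)$ (in the complex-valued case $\mathcal E(\bar u,v)$). For $x\in G$, $v_x\in\mathcal H_{\mathcal E}$ is the unique element with $\langle v_x,u\rangle_{\mathcal H_{\mathcal E}}=u(x)-u(o)$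 for all $u\in\mathcal H_{\mathcal E}$; $\operatorname{span}\{v_x\}$ is dense in $\mathcal H_{\mathcal E}$. $\ell^2(G)$ is the space of square-summable functions on $G$ (counting measure), with $\langle u,v\rangle_{\ell^2}=\sum_x u(x)v(x)$ (conjugate on $u$ in the complex case). $\delta_x$ denotes both the characteristic function of $\{x\}$ in $\ell^2(G)$ and the element of $\mathcal H_{\mathcal E}$ it represents (it has finite energy). Span means finite linear combinations. The operators $J$ and $M$ are densely defined and closable. *)

theory Defs
  imports
    "HOL-Analysis.Analysis"
    "HOL-Library.Function_Algebras"
    "Jordan_Normal_Form.Conjugate"
begin

section \<open>Scalars\<close>

text \<open>The only models of this class are the real and the complex numbers, so that a statement
  over it covers the real-valued and the complex-valued setting at once.  Addition on functions is
  pointwise, as set up by \<open>Function_Algebras\<close>.\<close>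

class rc_field = conjugatable_field + real_normed_field + banach +
  assumes mult_conjugate: "a * conjugate a = (norm a)\<^sup>2 *\<^sub>R 1"

instance real :: rc_field
  by intro_classes (simp add: power2_eq_square)

instance complex :: rc_field
  by intro_classes (simp add: complex_norm_square [symmetric] scaleR_conv_of_real del: of_real_power)


section \<open>Inner product spaces with a carrier, and operators between them\<close>

text \<open>The energy space depends on the conductances, hence cannot be a type.  The vector space
  operations are those of the ambient type; inner products are conjugate linear in the first
  argument.\<close>

record ('k, 'v) ip_space =
  vectors :: "'v set"
  iprod :: "'v \<Rightarrow> 'v \<Rightarrow> 'k"

definition ip_norm :: "('k::rc_field, 'v) ip_space \<Rightarrow> 'v \<Rightarrow> real" where
  "ip_norm H u = sqrt (norm (iprod H u u))"

text \<open>An operator, with its domain, is represented by its graph.  The adjoint of a densely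
  defined operator and the closure of a closable operator are again (graphs of) operators.\<close>

definition op_closure ::
  "('k::rc_field, 'u::minus) ip_space \<Rightarrow> ('k, 'w::minus) ip_space \<Rightarrow> ('u \<times> 'w) set \<Rightarrow> ('u \<times> 'w) set"
  where
  "op_closure H K T = {(u, w). u \<in> vectors H \<and> w \<in> vectors K \<and>
     (\<exists>s t. (\<forall>n::nat. (s n, t n) \<in> T) \<and>
            (\<lambda>n. ip_norm H (s n - u)) \<longlonglongrightarrow> 0 \<and> (\<lambda>n. ip_norm K (t n - w)) \<longlonglongrightarrow> 0)}"

definition op_adjoint ::
  "('k, 'u) ip_space \<Rightarrow> ('k, 'w) ip_space \<Rightarrow> ('u \<times> 'w) set \<Rightarrow> ('w \<times> 'u) set"
  where
  "op_adjoint H K T = {(w, u). w \<in> vectors K \<and> u \<in> vectors H \<and>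
     (\<forall>(x, y) \<in> T. iprod K y w = iprod H x u)}"


section \<open>Square-summable functions\<close>

definition ell2 :: "('k::rc_field, 'a \<Rightarrow> 'k) ip_space" where
  "ell2 = \<lparr>vectors = {f. (\<lambda>x. (norm (f x))\<^sup>2) summable_on UNIV},
           iprod = (\<lambda>f g. \<Sum>\<^sub>\<infinity>x. conjugate (f x) * g x)\<rparr>"

definition delta :: "'a \<Rightarrow> 'a \<Rightarrow> 'k::rc_field" where
  "delta x = (\<lambda>y. if y = x then 1 else 0)"

definition fun_scale :: "'k::rc_field \<Rightarrow> ('a \<Rightarrow> 'k) \<Rightarrow> ('a \<Rightarrow> 'k)" where
  "fun_scale k f = (\<lambda>x. k * f x)"

lemma module_fun_scale: "module fun_scale"
  by unfold_locales (auto simp: fun_scale_def algebra_simps)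


section \<open>Networks and their energy form\<close>

text \<open>The vertex set is the type \<open>'a\<close>.\<close>

definition network :: "('a \<Rightarrow> 'a \<Rightarrow> real) \<Rightarrow> bool" where
  "network c \<longleftrightarrow>
     (\<forall>x y. 0 \<le> c x y) \<and> (\<forall>x y. c x y = c y x) \<and> (\<forall>x. c x x = 0) \<and>
     (\<forall>x. finite {y. c x y > 0}) \<and>
     (\<forall>x y. (x, y) \<in> {(p, q). c p q > 0}\<^sup>*)"

text \<open>The form is bilinear also for complex scalars; the inner product of the energy space
  conjugates its first argument.\<close>

definition energy :: "('a \<Rightarrow> 'a \<Rightarrow> real) \<Rightarrow> ('a \<Rightarrow> 'k::rc_field) \<Rightarrow> ('a \<Rightarrow> 'k) \<Rightarrow> 'k" where
  "energy c u v = (\<Sum>\<^sub>\<infinity>(x, y). of_real (c x y) * ((u x - u y) * (v x - v y))) / 2"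

text \<open>An \<open>infsum\<close> that does not converge is \<open>0\<close>, so finiteness of the energy has to be expressed
  by summability.\<close>

definition finite_energy :: "('a \<Rightarrow> 'a \<Rightarrow> real) \<Rightarrow> ('a \<Rightarrow> 'k::rc_field) \<Rightarrow> bool" where
  "finite_energy c u \<longleftrightarrow> (\<lambda>(x, y). c x y * (norm (u x - u y))\<^sup>2) summable_on UNIV"


section \<open>The energy space\<close>

quotient_type (overloaded) ('a, 'k) fun_mod_const = "'a \<Rightarrow> 'k::rc_field"
  / "\<lambda>u v. \<exists>k. \<forall>x. u x = v x + k"
proof (rule equivpI)
  show "reflp (\<lambda>u v::'a \<Rightarrow> 'k. \<exists>k. \<forall>x. u x = v x + k)"
    by (rule reflpI, rule exI[of _ 0]) simp
  show "symp (\<lambda>u v::'a \<Rightarrow> 'k. \<exists>k. \<forall>x. u x = v x + k)"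
    by (rule sympI, erule exE, rule_tac x = "- k" in exI) simp
  show "transp (\<lambda>u v::'a \<Rightarrow> 'k. \<exists>k. \<forall>x. u x = v x + k)"
  proof (rule transpI, elim exE)
    fix u v w :: "'a \<Rightarrow> 'k" and k l
    assume "\<forall>x. u x = v x + k" "\<forall>x. v x = w x + l"
    then show "\<exists>k. \<forall>x. u x = w x + k"
      by (intro exI[of _ "l + k"]) (simp add: add.assoc)
  qed
qed

instantiation fun_mod_const :: (type, rc_field) ab_group_add
begin

lift_definition zero_fun_mod_const :: "('a, 'b) fun_mod_const" is "\<lambda>x. 0" .

lift_definition plus_fun_mod_const ::
  "('a, 'b) fun_mod_const \<Rightarrow> ('a, 'b) fun_mod_const \<Rightarrow> ('a, 'b) fun_mod_const"
  is "\<lambda>u v x. u x + v x"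
proof (elim exE)
  fix u u' v v' :: "'a \<Rightarrow> 'b" and k l
  assume "\<forall>x. u x = u' x + k" "\<forall>x. v x = v' x + l"
  then show "\<exists>k. \<forall>x. u x + v x = u' x + v' x + k"
    by (intro exI[of _ "k + l"]) (simp add: algebra_simps)
qed

lift_definition uminus_fun_mod_const :: "('a, 'b) fun_mod_const \<Rightarrow> ('a, 'b) fun_mod_const"
  is "\<lambda>u x. - u x"
proof (elim exE)
  fix u u' :: "'a \<Rightarrow> 'b" and k
  assume "\<forall>x. u x = u' x + k"
  then show "\<exists>k. \<forall>x. - u x = - u' x + k"
    by (intro exI[of _ "- k"]) simp
qed

lift_definition minus_fun_mod_const ::
  "('a, 'b) fun_mod_const \<Rightarrow> ('a, 'b) fun_mod_const \<Rightarrow> ('a, 'b) fun_mod_const"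
  is "\<lambda>u v x. u x - v x"
proof (elim exE)
  fix u u' v v' :: "'a \<Rightarrow> 'b" and k l
  assume "\<forall>x. u x = u' x + k" "\<forall>x. v x = v' x + l"
  then show "\<exists>k. \<forall>x. u x - v x = u' x - v' x + k"
    by (intro exI[of _ "k - l"]) (simp add: algebra_simps)
qed

instance
  by intro_classes (transfer, rule exI[of _ 0], simp add: algebra_simps)+

end

lift_definition fmc_scale ::
  "'k::rc_field \<Rightarrow> ('a, 'k) fun_mod_const \<Rightarrow> ('a, 'k) fun_mod_const"
  is "\<lambda>a u x. a * u x"
proof (elim exE)
  fix a k and u u' :: "'a \<Rightarrow> 'k"
  assume "\<forall>x. u x = u' x + k"
  then show "\<exists>k. \<forall>x. a * u x = a * u' x + k"
    by (intro exI[of _ "a * k"]) (simp add: algebra_simps)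
qed

lemma module_fmc_scale: "module fmc_scale"
  by unfold_locales (transfer, rule exI[of _ 0], simp add: algebra_simps)+

lift_definition fmc_of :: "('a \<Rightarrow> 'k::rc_field) \<Rightarrow> ('a, 'k) fun_mod_const" is "\<lambda>u. u" .

lift_definition fmc_diff :: "('a, 'k::rc_field) fun_mod_const \<Rightarrow> 'a \<Rightarrow> 'a \<Rightarrow> 'k"
  is "\<lambda>u x y. u x - u y"
  by (elim exE, intro ext) simp

lift_definition fmc_finite_energy ::
  "('a \<Rightarrow> 'a \<Rightarrow> real) \<Rightarrow> ('a, 'k::rc_field) fun_mod_const \<Rightarrow> bool"
  is finite_energy
  by (elim exE) (simp add: finite_energy_def)

lift_definition fmc_iprod ::
  "('a \<Rightarrow> 'a \<Rightarrow> real) \<Rightarrow> ('a, 'k::rc_field) fun_mod_const \<Rightarrow> ('a, 'k) fun_mod_const \<Rightarrow> 'k"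
  is "\<lambda>c u v. energy c (\<lambda>x. conjugate (u x)) v"
  by (elim exE) (simp add: energy_def conjugate_dist_add)

definition energy_space ::
  "('a \<Rightarrow> 'a \<Rightarrow> real) \<Rightarrow> ('k::rc_field, ('a, 'k) fun_mod_const) ip_space" where
  "energy_space c = \<lparr>vectors = {u. fmc_finite_energy c u}, iprod = fmc_iprod c\<rparr>"

text \<open>The dipole \<open>v\<^sub>x\<close>: the Riesz representative of the functional \<open>u \<mapsto> u(x) - u(o)\<close>.\<close>

definition energy_kernel ::
  "('a \<Rightarrow> 'a \<Rightarrow> real) \<Rightarrow> 'a \<Rightarrow> 'a \<Rightarrow> ('a, 'k::rc_field) fun_mod_const" where
  "energy_kernel c o\<^sub>0 x = (THE w. w \<in> vectors (energy_space c) \<and>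
     (\<forall>u \<in> vectors (energy_space c). iprod (energy_space c) w u = fmc_diff u x o\<^sub>0))"


section \<open>The operators\<close>

text \<open>Since \<open>fmc_of\<close> is linear, this is the linear extension of \<open>\<delta>\<^sub>x \<mapsto> \<delta>\<^sub>x\<close>.\<close>

definition J_op :: "(('a \<Rightarrow> 'k::rc_field) \<times> ('a, 'k) fun_mod_const) set" where
  "J_op = {(f, fmc_of f) | f. f \<in> module.span fun_scale (range delta)}"

definition M_op ::
  "('a \<Rightarrow> 'a \<Rightarrow> real) \<Rightarrow> 'a \<Rightarrow> (('a, 'k::rc_field) fun_mod_const \<times> ('a \<Rightarrow> 'k)) set" where
  "M_op c o\<^sub>0 =
     {(u, \<lambda>x. iprod (energy_space c) (fmc_of (delta x)) u) | u.
        u \<in> module.span fmc_scale (range (energy_kernel c o\<^sub>0))}"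

end

theory Submission
  imports Defs
begin

text \<open>All four operators can be described explicitly.  Since \<open>\<langle>\<delta>\<^sub>x, u\<rangle> = \<Delta>u(x)\<close> in the energy space,
  the adjoint of \<open>J\<close> is the maximal Laplacian, with graph consisting of all pairs \<open>(w, \<Delta>w)\<close> for which
  \<open>w\<close> has finite energy and \<open>\<Delta>w\<close> is square-summable (\<open>adjoint_J\<close>).  Since \<open>\<Delta>v\<^sub>x = \<delta>\<^sub>x - \<delta>\<^sub>o\<close>, the
  adjoint of \<open>M\<close> is the maximal inclusion, with graph consisting of all pairs \<open>(f, f)\<close> for which \<open>f\<close> is
  square-summable and of finite energy (\<open>adjoint_M\<close>).  The closures of \<open>J\<close> and \<open>M\<close> are contained in
  these graphs, because convergence in norm implies pointwise convergence (modulo constants), and all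
  sums that occur in \<open>\<Delta>\<close> are finite.

  It remains to see that the graph of \<open>J\<close> is dense in the maximal inclusion and the graph of \<open>M\<close> is
  dense in the maximal Laplacian.  By orthogonal projection it is enough that an element of the larger
  graph which is orthogonal to the smaller one vanishes.  If \<open>(f, f)\<close> is orthogonal to all
  \<open>(\<delta>\<^sub>x, \<delta>\<^sub>x)\<close>, then \<open>f + \<Delta>f = 0\<close>.  If \<open>(w, \<Delta>w)\<close> is orthogonal to all \<open>(v\<^sub>x, \<delta>\<^sub>x - \<delta>\<^sub>o)\<close>, then
  \<open>w + \<Delta>w\<close> is constant, so that \<open>u = \<Delta>w\<close> satisfies \<open>u + \<Delta>u = 0\<close>.  In both cases the solution is
  square-summable, and a maximum principle (\<open>ell2_laplacian_eigenfunction_zero\<close>) shows that it is \<open>0\<close>.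

  The Hilbert space theory is carried out for square-summable functions only.  The weighted gradient
  embeds the energy space isometrically into the square-summable functions on pairs of vertices, and a
  pair of square-summable functions is a square-summable function on a disjoint union.  Hence
  \<open>ell2_orthogonal_decomposition\<close> yields both density statements as well as the dipoles \<open>v\<^sub>x\<close>; limits are
  identified pointwise, using connectedness to recover a function from its gradient
  (\<open>gradient_limit\<close>).\<close>


section \<open>Scalars\<close>

lemma conjugate_mult_self: "conjugate a * a = of_real ((norm a)\<^sup>2)" for a :: "'k::rc_field"
  using mult_conjugate[of a] by (simp add: mult.commute of_real_def)

lemma conjugate_of_real [simp]: "conjugate (of_real r :: 'k::rc_field) = of_real r"
proof -
  \<comment> \<open>A nonnegative real number is of the form \<open>a\<^sup>* a\<close>, which is invariant under conjugation.\<close>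
  have nonneg: "conjugate (of_real s :: 'k) = of_real s" if "s \<ge> 0" for s :: real
  proof -
    define a :: 'k where "a = of_real (sqrt s)"
    have a: "conjugate a * a = of_real s"
      using that by (simp add: conjugate_mult_self a_def)
    have "conjugate (conjugate a * a) = conjugate a * a"
      by (simp add: conjugate_dist_mul mult.commute)
    then show ?thesis by (simp only: a)
  qed
  show ?thesis
  proof (cases "r \<ge> 0")
    case False
    then have "conjugate (- of_real (- r) :: 'k) = - of_real (- r)"
      by (simp only: conjugate_neg nonneg)
    then show ?thesis by simp
  qed (rule nonneg)
qed

lemma conjugate_one [simp]: "conjugate (1 :: 'k::rc_field) = 1"
  using conjugate_of_real[of 1, where ?'k = 'k] by simp

lemma conjugate_diff: "conjugate (a - b) = conjugate a - conjugate b" for a b :: "'k::rc_field"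
  using conjugate_dist_add[of a "- b"] by (simp add: conjugate_neg)

lemma norm_conjugate [simp]: "norm (conjugate a) = norm a" for a :: "'k::rc_field"
proof -
  have "(of_real ((norm (conjugate a))\<^sup>2) :: 'k) = of_real ((norm a)\<^sup>2)"
    using conjugate_mult_self[of a] conjugate_mult_self[of "conjugate a"] by (simp add: mult.commute)
  then show ?thesis by (simp only: of_real_eq_iff) simp
qed

lemma conjugate_bounded_linear: "bounded_linear (conjugate :: 'k::rc_field \<Rightarrow> 'k)"
  by (rule bounded_linear_intro[where K = 1])
     (simp_all add: conjugate_dist_add scaleR_conv_of_real conjugate_dist_mul)

lemma norm_parallelogram:
  "(norm (a + b))\<^sup>2 + (norm (a - b))\<^sup>2 = 2 * (norm a)\<^sup>2 + 2 * (norm b)\<^sup>2" for a b :: "'k::rc_field"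
proof -
  have "(of_real ((norm (a + b))\<^sup>2 + (norm (a - b))\<^sup>2) :: 'k)
      = of_real (2 * (norm a)\<^sup>2 + 2 * (norm b)\<^sup>2)"
    unfolding of_real_add of_real_mult conjugate_mult_self [symmetric]
    by (simp add: conjugate_dist_add conjugate_diff algebra_simps)
  then show ?thesis by (simp only: of_real_eq_iff)
qed


section \<open>Square-summable functions\<close>

interpretation fun_scale: module fun_scale
  by (rule module_fun_scale)

lemma fun_scale_apply [simp]: "fun_scale k f x = k * f x"
  by (simp add: fun_scale_def)

lemma mem_ell2: "f \<in> vectors ell2 \<longleftrightarrow> (\<lambda>x. (norm (f x))\<^sup>2) summable_on UNIV"
  by (simp add: ell2_def)

lemma ell2_iprod: "iprod ell2 f g = (\<Sum>\<^sub>\<infinity>x. conjugate (f x) * g x)"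
  by (simp add: ell2_def)

lemma norm_add_sq_le: "(norm (a + b))\<^sup>2 \<le> 2 * (norm a)\<^sup>2 + 2 * (norm b)\<^sup>2"
  for a b :: "'k::rc_field"
  using norm_parallelogram[of a b] zero_le_power2[of "norm (a - b)"] by linarith

lemma ell2_add: "f \<in> vectors ell2 \<Longrightarrow> g \<in> vectors ell2 \<Longrightarrow> f + g \<in> vectors ell2"
  unfolding mem_ell2
  by (rule summable_on_comparison_test[where f = "\<lambda>x. 2 * (norm (f x))\<^sup>2 + 2 * (norm (g x))\<^sup>2"])
     (auto intro!: summable_on_add summable_on_cmult_right norm_add_sq_le)

lemma ell2_scale: "f \<in> vectors ell2 \<Longrightarrow> fun_scale k f \<in> vectors ell2"
  by (simp add: mem_ell2 norm_mult power_mult_distrib summable_on_cmult_right)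

lemma ell2_zero: "0 \<in> vectors ell2"
  by (simp add: mem_ell2)

lemma subspace_ell2: "module.subspace fun_scale (vectors ell2)"
  by (intro fun_scale.subspaceI ell2_add ell2_scale ell2_zero)

lemmas ell2_diff = fun_scale.subspace_diff[OF subspace_ell2]

lemma ell2_finite_support:
  assumes "finite A" "\<And>x. x \<notin> A \<Longrightarrow> f x = 0"
  shows "f \<in> vectors ell2"
  unfolding mem_ell2
  by (rule finite_nonzero_values_imp_summable_on, rule finite_subset[OF _ assms(1)])
     (use assms(2) in force)

lemma ell2_mult_summable:
  assumes "f \<in> vectors ell2" "g \<in> vectors ell2"
  shows "(\<lambda>x. conjugate (f x) * g x) summable_on UNIV"
proof (rule abs_summable_summable, rule summable_on_comparison_test)
  show "(\<lambda>x. (norm (f x))\<^sup>2 + (norm (g x))\<^sup>2) summable_on UNIV"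
    using assms by (intro summable_on_add) (simp_all add: mem_ell2)
  show "norm (conjugate (f x) * g x) \<le> (norm (f x))\<^sup>2 + (norm (g x))\<^sup>2" for x
    using sum_squares_bound[of "norm (f x)" "norm (g x)"]
          mult_nonneg_nonneg[of "norm (f x)" "norm (g x)"]
    by (simp add: norm_mult del: mult_nonneg_nonneg)
qed simp

lemma ell2_iprod_add_right:
  "f \<in> vectors ell2 \<Longrightarrow> g \<in> vectors ell2 \<Longrightarrow> h \<in> vectors ell2 \<Longrightarrow>
     iprod ell2 f (g + h) = iprod ell2 f g + iprod ell2 f h"
  unfolding ell2_iprod
  by (subst infsum_add [symmetric]) (auto intro: ell2_mult_summable simp: distrib_left)

lemma ell2_iprod_scale_right: "iprod ell2 f (fun_scale k g) = k * iprod ell2 f g"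
  unfolding ell2_iprod by (subst infsum_cmult_right' [symmetric]) (simp add: mult_ac)

lemma ell2_iprod_diff_right:
  "f \<in> vectors ell2 \<Longrightarrow> g \<in> vectors ell2 \<Longrightarrow> h \<in> vectors ell2 \<Longrightarrow>
     iprod ell2 f (g - h) = iprod ell2 f g - iprod ell2 f h"
  using ell2_iprod_add_right[of f "g - h" h] ell2_diff[of g h] by simp

lemma ell2_iprod_conjugate:
  assumes "f \<in> vectors ell2" "g \<in> vectors ell2"
  shows "conjugate (iprod ell2 f g) = iprod ell2 g f"
proof -
  have "(\<Sum>\<^sub>\<infinity>x. conjugate (conjugate (f x) * g x)) = conjugate (\<Sum>\<^sub>\<infinity>x. conjugate (f x) * g x)"
    by (rule infsum_bounded_linear_strong[OF _ conjugate_bounded_linear])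
       (intro iffI ell2_mult_summable[OF assms]
          summable_on_bounded_linear[OF conjugate_bounded_linear])
  then show ?thesis by (simp add: ell2_iprod conjugate_dist_mul mult.commute)
qed

lemma ell2_iprod_add_left:
  "f \<in> vectors ell2 \<Longrightarrow> g \<in> vectors ell2 \<Longrightarrow> h \<in> vectors ell2 \<Longrightarrow>
     iprod ell2 (f + g) h = iprod ell2 f h + iprod ell2 g h"
  unfolding ell2_iprod
  by (subst infsum_add [symmetric])
     (auto intro: ell2_mult_summable simp: conjugate_dist_add distrib_right)

lemma ell2_iprod_diff_left:
  "f \<in> vectors ell2 \<Longrightarrow> g \<in> vectors ell2 \<Longrightarrow> h \<in> vectors ell2 \<Longrightarrow>
     iprod ell2 (f - g) h = iprod ell2 f h - iprod ell2 g h"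
  using ell2_iprod_add_left[of "f - g" g h] ell2_diff[of f g] by simp

lemma ell2_iprod_scale_left: "iprod ell2 (fun_scale k f) g = conjugate k * iprod ell2 f g"
  unfolding ell2_iprod
  by (subst infsum_cmult_right' [symmetric]) (simp add: mult_ac conjugate_dist_mul)

lemma ell2_iprod_self:
  assumes "f \<in> vectors ell2"
  shows "iprod ell2 f f = of_real (\<Sum>\<^sub>\<infinity>x. (norm (f x))\<^sup>2)"
  unfolding ell2_iprod conjugate_mult_self
  using assms by (intro infsumI has_sum_of_real) (simp add: mem_ell2)

lemma ell2_norm_sq:
  assumes "f \<in> vectors ell2"
  shows "(ip_norm ell2 f)\<^sup>2 = (\<Sum>\<^sub>\<infinity>x. (norm (f x))\<^sup>2)"
  using assms by (simp add: ip_norm_def ell2_iprod_self infsum_nonneg)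

lemma ip_norm_nonneg [simp]: "ip_norm H f \<ge> 0"
  by (simp add: ip_norm_def)

lemma ell2_iprod_self_norm: "f \<in> vectors ell2 \<Longrightarrow> iprod ell2 f f = of_real ((ip_norm ell2 f)\<^sup>2)"
  by (simp only: ell2_iprod_self ell2_norm_sq)

lemma ell2_finite_sum_le:
  assumes "f \<in> vectors ell2" "finite F"
  shows "(\<Sum>x\<in>F. (norm (f x))\<^sup>2) \<le> (ip_norm ell2 f)\<^sup>2"
  unfolding ell2_norm_sq[OF assms(1)]
  using assms by (intro finite_sum_le_infsum) (auto simp: mem_ell2)

lemma ell2_norm_le_iff:
  assumes "b \<ge> 0" "\<And>F. finite F \<Longrightarrow> (\<Sum>x\<in>F. (norm (f x))\<^sup>2) \<le> b\<^sup>2"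
  shows "f \<in> vectors ell2 \<and> ip_norm ell2 f \<le> b"
proof
  show f: "f \<in> vectors ell2"
    unfolding mem_ell2
    by (rule nonneg_bdd_above_summable_on) (auto intro!: bdd_aboveI[where M = "b\<^sup>2"] assms(2))
  have "(ip_norm ell2 f)\<^sup>2 \<le> b\<^sup>2"
    unfolding ell2_norm_sq[OF f] using f assms(2)
    by (intro infsum_le_finite_sums) (auto simp: mem_ell2)
  then show "ip_norm ell2 f \<le> b" using assms(1) by (simp add: power2_le_iff_abs_le)
qed

lemma ell2_norm_component: "f \<in> vectors ell2 \<Longrightarrow> norm (f x) \<le> ip_norm ell2 f"
  using ell2_finite_sum_le[of f "{x}"] by (simp add: power2_le_iff_abs_le)

lemma ell2_norm_zero_imp: "f \<in> vectors ell2 \<Longrightarrow> ip_norm ell2 f = 0 \<Longrightarrow> f = 0"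
  using ell2_norm_component[of f] by (auto simp: fun_eq_iff)

lemma ell2_norm_triangle:
  assumes f: "f \<in> vectors ell2" and g: "g \<in> vectors ell2"
  shows "ip_norm ell2 (f + g) \<le> ip_norm ell2 f + ip_norm ell2 g"
proof (rule ell2_norm_le_iff[THEN conjunct2])
  fix F :: "'a set" assume F: "finite F"
  let ?L = "\<lambda>f. L2_set (\<lambda>x. norm (f x)) F"
  have le: "?L f \<le> ip_norm ell2 f" if "f \<in> vectors ell2" for f :: "'a \<Rightarrow> 'b"
    unfolding L2_set_def using ell2_finite_sum_le[OF that F] by (intro real_le_lsqrt) (auto intro: sum_nonneg)
  have "?L (f + g) \<le> L2_set (\<lambda>x. norm (f x) + norm (g x)) F"
    by (intro L2_set_mono) (auto intro: norm_triangle_ineq)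
  also have "\<dots> \<le> ?L f + ?L g" by (rule L2_set_triangle_ineq)
  finally have "?L (f + g) \<le> ip_norm ell2 f + ip_norm ell2 g" using le[OF f] le[OF g] by linarith
  then have "(?L (f + g))\<^sup>2 \<le> (ip_norm ell2 f + ip_norm ell2 g)\<^sup>2"
    by (rule power_mono) simp
  then show "(\<Sum>x\<in>F. (norm ((f + g) x))\<^sup>2) \<le> (ip_norm ell2 f + ip_norm ell2 g)\<^sup>2"
    by (simp add: L2_set_def sum_nonneg)
qed simp

lemma ell2_norm_minus_commute: "ip_norm ell2 (f - g) = ip_norm ell2 (g - f)"
  unfolding ip_norm_def ell2_iprod conjugate_mult_self by (simp add: norm_minus_commute)

lemma ell2_norm_scale: "ip_norm ell2 (fun_scale k f) = norm k * ip_norm ell2 f"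
  by (simp add: ip_norm_def ell2_iprod_scale_left ell2_iprod_scale_right norm_mult real_sqrt_mult
        mult.assoc [symmetric] power2_eq_square [symmetric])

lemma ell2_parallelogram:
  assumes f: "f \<in> vectors ell2" and g: "g \<in> vectors ell2"
  shows "(ip_norm ell2 (f + g))\<^sup>2 + (ip_norm ell2 (f - g))\<^sup>2
           = 2 * (ip_norm ell2 f)\<^sup>2 + 2 * (ip_norm ell2 g)\<^sup>2"
proof -
  have "(of_real ((ip_norm ell2 (f + g))\<^sup>2 + (ip_norm ell2 (f - g))\<^sup>2) :: 'b)
           = of_real (2 * (ip_norm ell2 f)\<^sup>2 + 2 * (ip_norm ell2 g)\<^sup>2)"
    unfolding of_real_add of_real_mult
    using f g
    by (simp only: ell2_iprod_self_norm [symmetric] ell2_add ell2_diff ell2_iprod_add_left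
        ell2_iprod_add_right ell2_iprod_diff_left ell2_iprod_diff_right) (simp add: algebra_simps)
  then show ?thesis by (simp only: of_real_eq_iff)
qed

text \<open>Completeness, with the Cauchy condition in the form in which it arises from the parallelogram
  law.\<close>

lemma ell2_complete:
  fixes e :: "nat \<Rightarrow> 'i \<Rightarrow> 'k::rc_field"
  assumes e: "\<And>n. e n \<in> vectors ell2" and b: "b \<longlonglongrightarrow> 0"
    and le: "\<And>m n. (ip_norm ell2 (e m - e n))\<^sup>2 \<le> b m + b n"
  obtains r where "r \<in> vectors ell2" "(\<lambda>n. ip_norm ell2 (e n - r)) \<longlonglongrightarrow> 0"
proof -
  have b_nonneg: "b n \<ge> 0" for n
    using order.trans[OF zero_le_power2 le[of n n]] by simp
  have "Cauchy (\<lambda>n. e n x)" for x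
  proof (rule metric_CauchyI)
    fix \<epsilon> :: real assume "\<epsilon> > 0"
    then have "eventually (\<lambda>n. b n < \<epsilon>\<^sup>2 / 2) sequentially"
      by (intro order_tendstoD(2)[OF b]) simp
    then obtain N where N: "\<And>n. n \<ge> N \<Longrightarrow> b n < \<epsilon>\<^sup>2 / 2"
      by (auto simp: eventually_sequentially)
    have "dist (e m x) (e n x) < \<epsilon>" if "m \<ge> N" "n \<ge> N" for m n
    proof -
      have "dist (e m x) (e n x) \<le> ip_norm ell2 (e m - e n)"
        using ell2_norm_component[OF ell2_diff[OF e e], of m n x] by (simp add: dist_norm)
      moreover have "(ip_norm ell2 (e m - e n))\<^sup>2 < \<epsilon>\<^sup>2"
        using le[of m n] N[OF that(1)] N[OF that(2)] by linarith
      ultimately show ?thesis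
        using \<open>\<epsilon> > 0\<close> by (meson order.strict_trans1 power2_less_imp_less order.strict_implies_order)
    qed
    then show "\<exists>M. \<forall>m\<ge>M. \<forall>n\<ge>M. dist (e m x) (e n x) < \<epsilon>" by blast
  qed
  then have "\<exists>l. (\<lambda>n. e n x) \<longlonglongrightarrow> l" for x
    by (metis Cauchy_convergent convergent_def)
  then obtain r where r: "\<And>x. (\<lambda>n. e n x) \<longlonglongrightarrow> r x" by metis
  \<comment> \<open>The Cauchy estimate passes to the limit on each finite set of indices.\<close>
  have diff: "e n - r \<in> vectors ell2 \<and> ip_norm ell2 (e n - r) \<le> sqrt (b n)" for n
  proof (rule ell2_norm_le_iff)
    fix F :: "'i set" assume F: "finite F"
    have "(\<lambda>m. \<Sum>x\<in>F. (norm ((e n - e m) x))\<^sup>2) \<longlonglongrightarrow> (\<Sum>x\<in>F. (norm ((e n - r) x))\<^sup>2)"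
      by (simp, intro tendsto_intros r)
    moreover have "(\<lambda>m. b n + b m) \<longlonglongrightarrow> b n + 0" by (intro tendsto_intros b)
    moreover have "(\<Sum>x\<in>F. (norm ((e n - e m) x))\<^sup>2) \<le> b n + b m" for m
      using ell2_finite_sum_le[OF ell2_diff[OF e e] F, of n m] le[of n m] by linarith
    ultimately have "(\<Sum>x\<in>F. (norm ((e n - r) x))\<^sup>2) \<le> b n + 0"
      by (intro LIMSEQ_le) auto
    then show "(\<Sum>x\<in>F. (norm ((e n - r) x))\<^sup>2) \<le> (sqrt (b n))\<^sup>2" using b_nonneg[of n] by simp
  qed (simp add: b_nonneg)
  have "r = e 0 - (e 0 - r)" by (simp add: fun_eq_iff)
  then have "r \<in> vectors ell2" using ell2_diff[OF e diff[THEN conjunct1], of 0 0] by simp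
  moreover have "(\<lambda>n. ip_norm ell2 (e n - r)) \<longlonglongrightarrow> 0"
  proof (rule tendsto_sandwich[where f = "\<lambda>_. 0" and h = "\<lambda>n. sqrt (b n)"])
    show "(\<lambda>n. sqrt (b n)) \<longlonglongrightarrow> 0" using tendsto_real_sqrt[OF b] by simp
  qed (use diff in auto)
  ultimately show ?thesis by (rule that)
qed

lemma ell2_tendsto_component:
  assumes "\<And>n. e n \<in> vectors ell2" "r \<in> vectors ell2" "(\<lambda>n. ip_norm ell2 (e n - r)) \<longlonglongrightarrow> 0"
  shows "(\<lambda>n. e n x) \<longlonglongrightarrow> r x"
proof -
  have "(\<lambda>n. e n x - r x) \<longlonglongrightarrow> 0"
    by (rule Lim_null_comparison[OF _ assms(3)])
       (use ell2_norm_component[OF ell2_diff[OF assms(1,2)], of _ x] in auto)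
  then show ?thesis by (simp add: LIM_zero_iff)
qed

text \<open>The projection theorem: \<open>r\<close> is the component of \<open>a\<close> orthogonal to \<open>S\<close>, and \<open>s\<close> converges to the
  component in the closure of \<open>S\<close>.\<close>

lemma ell2_orthogonal_decomposition:
  fixes S :: "('i \<Rightarrow> 'k::rc_field) set"
  assumes S: "module.subspace fun_scale S" "S \<subseteq> vectors ell2" and a: "a \<in> vectors ell2"
  obtains r s where "r \<in> vectors ell2" "\<And>n. s n \<in> S"
    "(\<lambda>n. ip_norm ell2 (a - s n - r)) \<longlonglongrightarrow> 0" "\<And>g. g \<in> S \<Longrightarrow> iprod ell2 g r = 0"
proof -
  let ?N = "ip_norm ell2 :: ('i \<Rightarrow> 'k) \<Rightarrow> real"
  define d where "d = (INF s\<in>S. (?N (a - s))\<^sup>2)"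
  have bdd: "bdd_below ((\<lambda>s. (?N (a - s))\<^sup>2) ` S)" by (rule bdd_belowI[where m = 0]) auto
  have d_le: "d \<le> (?N (a - s))\<^sup>2" if "s \<in> S" for s
    unfolding d_def using bdd that by (rule cINF_lower)
  have d_nonneg: "d \<ge> 0"
    unfolding d_def using fun_scale.subspace_0[OF S(1)] by (intro cINF_greatest) auto
  have "\<exists>s\<in>S. (?N (a - s))\<^sup>2 < d + 1 / Suc n" for n
  proof -
    have "d < d + 1 / Suc n" by simp
    then show ?thesis
      unfolding d_def using fun_scale.subspace_0[OF S(1)] bdd by (subst (asm) cINF_less_iff) auto
  qed
  then obtain s where s: "\<And>n. s n \<in> S" "\<And>n. (?N (a - s n))\<^sup>2 < d + 1 / Suc n" by metis
  define e where "e n = a - s n" for n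
  have e: "e n \<in> vectors ell2" for n unfolding e_def using S a s by (intro ell2_diff) auto
  have b: "(\<lambda>n. 2 * (1 / real (Suc n))) \<longlonglongrightarrow> 0"
    using tendsto_mult_right[OF lim_1_over_n[THEN LIMSEQ_Suc], of 2] by simp
  \<comment> \<open>The midpoint of \<open>s m\<close> and \<open>s n\<close> lies in \<open>S\<close>, hence the parallelogram law makes a minimizing
    sequence a Cauchy sequence.\<close>
  have cauchy: "(?N (e m - e n))\<^sup>2 \<le> 2 * (1 / real (Suc m)) + 2 * (1 / real (Suc n))" for m n
  proof -
    have "fun_scale (of_real (1/2)) (s m + s n) \<in> S"
      using S(1) s(1) by (intro fun_scale.subspace_scale fun_scale.subspace_add)
    then have "d \<le> (?N (a - fun_scale (of_real (1/2)) (s m + s n)))\<^sup>2" by (rule d_le)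
    moreover have "e m + e n = fun_scale 2 (a - fun_scale (of_real (1/2)) (s m + s n))"
      by (simp add: e_def fun_eq_iff field_simps)
    then have "?N (e m + e n) = 2 * ?N (a - fun_scale (of_real (1/2)) (s m + s n))"
      by (simp add: ell2_norm_scale)
    ultimately have "4 * d \<le> (?N (e m + e n))\<^sup>2" by (simp add: power_mult_distrib)
    then show ?thesis
      using ell2_parallelogram[OF e e, of m n] s(2)[of m] s(2)[of n] unfolding e_def by linarith
  qed
  obtain r where r: "r \<in> vectors ell2" "(\<lambda>n. ?N (e n - r)) \<longlonglongrightarrow> 0"
    using ell2_complete[of e, OF e b cauchy] by blast
  have r_le: "?N r \<le> sqrt d"
  proof (rule LIMSEQ_le)
    have "(\<lambda>n. sqrt (d + 1 / real (Suc n)) + ?N (e n - r)) \<longlonglongrightarrow> sqrt (d + 0) + 0"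
      using lim_1_over_n[THEN LIMSEQ_Suc] by (intro tendsto_intros r) auto
    then show "(\<lambda>n. sqrt (d + 1 / real (Suc n)) + ?N (e n - r)) \<longlonglongrightarrow> sqrt d" by simp
    have "?N r \<le> sqrt (d + 1 / real (Suc n)) + ?N (e n - r)" for n
    proof -
      have "?N (e n) \<le> sqrt (d + 1 / real (Suc n))"
        using s(2)[of n] by (intro real_le_rsqrt) (simp add: e_def)
      moreover have "?N (e n + (r - e n)) \<le> ?N (e n) + ?N (r - e n)"
        using e r by (intro ell2_norm_triangle ell2_diff)
      ultimately show ?thesis by (simp add: ell2_norm_minus_commute[of r])
    qed
    then show "\<exists>N. \<forall>n\<ge>N. ?N r \<le> sqrt (d + 1 / real (Suc n)) + ?N (e n - r)" by blast
  qed auto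
  have r_min: "sqrt d \<le> ?N (r - g)" if g: "g \<in> S" for g
  proof (rule LIMSEQ_le)
    have "(\<lambda>n. ?N (e n - r) + ?N (r - g)) \<longlonglongrightarrow> 0 + ?N (r - g)"
      by (intro tendsto_intros r)
    then show "(\<lambda>n. ?N (e n - r) + ?N (r - g)) \<longlonglongrightarrow> ?N (r - g)" by simp
    have "sqrt d \<le> ?N (e n - r) + ?N (r - g)" for n
    proof -
      have "e n - g = a - (s n + g)" by (simp add: e_def diff_diff_add)
      then have "sqrt d \<le> ?N (e n - g)"
        using d_le[OF fun_scale.subspace_add[OF S(1) s(1) g], of n]
        by (intro real_le_lsqrt) (auto simp: diff_diff_add)
      also have "\<dots> = ?N ((e n - r) + (r - g))" by simp
      also have "\<dots> \<le> ?N (e n - r) + ?N (r - g)"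
        using e r S g by (intro ell2_norm_triangle ell2_diff) auto
      finally show ?thesis .
    qed
    then show "\<exists>N. \<forall>n\<ge>N. sqrt d \<le> ?N (e n - r) + ?N (r - g)" by blast
  qed auto
  have orth: "iprod ell2 g r = 0" if g: "g \<in> S" for g
  proof -
    have gL: "g \<in> vectors ell2" using g S by auto
    \<comment> \<open>A nonzero \<open>p\<close> would make \<open>r - \<epsilon> p g\<close> shorter than \<open>r\<close>; this choice of \<open>\<epsilon>\<close> is small enough.\<close>
    define p where "p = iprod ell2 g r"
    define \<epsilon> where "\<epsilon> = 1 / (1 + (?N g)\<^sup>2)"
    let ?h = "fun_scale (of_real \<epsilon> * p) g"
    have h: "?h \<in> S" "?h \<in> vectors ell2"
      using S(1) g gL by (auto intro: fun_scale.subspace_scale ell2_scale)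
    have p': "iprod ell2 r g = conjugate p" by (simp add: p_def ell2_iprod_conjugate gL r)
    have "(of_real ((?N (r - ?h))\<^sup>2) :: 'k)
        = of_real ((?N r)\<^sup>2 - 2 * \<epsilon> * (norm p)\<^sup>2 + \<epsilon>\<^sup>2 * (norm p)\<^sup>2 * (?N g)\<^sup>2)"
      unfolding ell2_iprod_self_norm[OF ell2_diff[OF r(1) h(2)], symmetric]
        ell2_iprod_diff_left[OF r(1) h(2) ell2_diff[OF r(1) h(2)]]
        ell2_iprod_diff_right[OF r(1) r(1) h(2)] ell2_iprod_scale_left ell2_iprod_diff_right[OF gL r(1) h(2)]
        ell2_iprod_scale_right
      unfolding of_real_add of_real_diff of_real_mult of_real_power
      unfolding of_real_power[symmetric] ell2_iprod_self_norm[OF r(1), symmetric]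
        ell2_iprod_self_norm[OF gL, symmetric] p_def[symmetric] p'
        conjugate_mult_self[symmetric]
      by (simp add: conjugate_dist_mul power2_eq_square algebra_simps)
    then have eq: "(?N (r - ?h))\<^sup>2 = (?N r)\<^sup>2 - 2 * \<epsilon> * (norm p)\<^sup>2 + \<epsilon>\<^sup>2 * (norm p)\<^sup>2 * (?N g)\<^sup>2"
      by (simp only: of_real_eq_iff)
    have "?N r \<le> ?N (r - ?h)" using r_le r_min[OF h(1)] by linarith
    then have "(?N r)\<^sup>2 \<le> (?N (r - ?h))\<^sup>2" by (rule power_mono) simp
    then have "\<epsilon> * (norm p)\<^sup>2 * (2 - \<epsilon> * (?N g)\<^sup>2) \<le> 0"
      unfolding eq by (simp add: algebra_simps power2_eq_square)
    moreover have pos: "1 + (?N g)\<^sup>2 > 0" by (simp add: add_pos_nonneg)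
    have "\<epsilon> > 0" "2 - \<epsilon> * (?N g)\<^sup>2 > 0"
      using pos by (simp_all add: \<epsilon>_def field_simps)
    ultimately have "(norm p)\<^sup>2 \<le> 0"
      by (simp add: mult_le_0_iff)
    then show ?thesis by (simp add: p_def)
  qed
  show ?thesis using r s(1) orth unfolding e_def by (intro that)
qed


lemma has_sum_sum_type:
  fixes F :: "'i + 'j \<Rightarrow> 'b::topological_comm_monoid_add"
  assumes "((\<lambda>x. F (Inl x)) has_sum a) UNIV" "((\<lambda>y. F (Inr y)) has_sum b) UNIV"
  shows "(F has_sum (a + b)) UNIV"
proof -
  have "(F has_sum a) (range Inl)" "(F has_sum b) (range Inr)"
    using assms by (simp_all add: has_sum_reindex o_def)
  then have "(F has_sum (a + b)) (range Inl \<union> range Inr)"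
    by (rule has_sum_Un_disjoint) auto
  then show ?thesis by (simp add: UNIV_sum)
qed

lemma ell2_case_sum:
  "case_sum f g \<in> vectors ell2 \<longleftrightarrow> f \<in> vectors ell2 \<and> g \<in> vectors ell2"
proof (intro iffI conjI)
  assume fg: "case_sum f g \<in> vectors ell2"
  have "(\<lambda>x. (norm (case_sum f g x))\<^sup>2) summable_on range Inl"
    "(\<lambda>x. (norm (case_sum f g x))\<^sup>2) summable_on range Inr"
    using fg unfolding mem_ell2 by (auto intro: summable_on_subset)
  then show "f \<in> vectors ell2" "g \<in> vectors ell2"
    by (simp_all add: mem_ell2 summable_on_reindex o_def)
next
  assume "f \<in> vectors ell2 \<and> g \<in> vectors ell2"
  then show "case_sum f g \<in> vectors ell2"
    unfolding mem_ell2 summable_on_def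
    using has_sum_sum_type[of "\<lambda>x. (norm (case_sum f g x))\<^sup>2"] by auto
qed

lemma ell2_iprod_case_sum:
  assumes "f \<in> vectors ell2" "g \<in> vectors ell2" "f' \<in> vectors ell2" "g' \<in> vectors ell2"
  shows "iprod ell2 (case_sum f g) (case_sum f' g') = iprod ell2 f f' + iprod ell2 g g'"
  unfolding ell2_iprod
  by (rule infsumI, rule has_sum_sum_type)
     (use assms in \<open>auto intro: ell2_mult_summable has_sum_infsum\<close>)

lemma ell2_norm_case_sum:
  assumes "f \<in> vectors ell2" "g \<in> vectors ell2"
  shows "ip_norm ell2 f \<le> ip_norm ell2 (case_sum f g)"
    "ip_norm ell2 g \<le> ip_norm ell2 (case_sum f g)"
proof -
  have "(of_real ((ip_norm ell2 (case_sum f g))\<^sup>2) :: 'b)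
      = of_real ((ip_norm ell2 f)\<^sup>2 + (ip_norm ell2 g)\<^sup>2)"
    unfolding of_real_add
    by (simp only: ell2_iprod_self_norm[symmetric] assms ell2_case_sum ell2_iprod_case_sum)
  then have "(ip_norm ell2 (case_sum f g))\<^sup>2 = (ip_norm ell2 f)\<^sup>2 + (ip_norm ell2 g)\<^sup>2"
    by (simp only: of_real_eq_iff)
  then show "ip_norm ell2 f \<le> ip_norm ell2 (case_sum f g)"
    "ip_norm ell2 g \<le> ip_norm ell2 (case_sum f g)"
    by (auto intro: power2_le_imp_le)
qed

lemma delta_in_ell2: "delta x \<in> vectors ell2"
  by (rule ell2_finite_support[of "{x}"]) (simp_all add: delta_def)

lemma ell2_iprod_delta: "iprod ell2 (delta x) f = f x"
  unfolding ell2_iprod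
  by (intro infsumI has_sum_finite_neutralI[of "{x}"]) (simp_all add: delta_def)


section \<open>Gradient and Laplacian\<close>

text \<open>Weighting differences by \<open>sqrt (c x y / 2)\<close> makes the gradient an isometry of the energy
  space into the square-summable functions on ordered pairs of vertices.\<close>

definition gradient :: "('a \<Rightarrow> 'a \<Rightarrow> real) \<Rightarrow> ('a \<Rightarrow> 'k::rc_field) \<Rightarrow> 'a \<times> 'a \<Rightarrow> 'k" where
  "gradient c u = (\<lambda>(x, y). of_real (sqrt (c x y / 2)) * (u x - u y))"

text \<open>The sign is chosen such that the Laplacian is a nonnegative operator.\<close>

definition laplacian :: "('a \<Rightarrow> 'a \<Rightarrow> real) \<Rightarrow> ('a \<Rightarrow> 'k::rc_field) \<Rightarrow> 'a \<Rightarrow> 'k" where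
  "laplacian c u x = (\<Sum>y | c x y > 0. of_real (c x y) * (u x - u y))"

lemma gradient_zero [simp]: "gradient c 0 = 0"
  and gradient_add: "gradient c (u + v) = gradient c u + gradient c v"
  and gradient_diff: "gradient c (u - v) = gradient c u - gradient c v"
  and gradient_scale: "gradient c (fun_scale k u) = fun_scale k (gradient c u)"
  by (auto simp: gradient_def fun_eq_iff algebra_simps)

lemma laplacian_zero [simp]: "laplacian c 0 = 0"
  and laplacian_add: "laplacian c (u + v) = laplacian c u + laplacian c v"
  and laplacian_diff: "laplacian c (u - v) = laplacian c u - laplacian c v"
  and laplacian_scale: "laplacian c (fun_scale k u) = fun_scale k (laplacian c u)"
  by (auto simp: laplacian_def fun_eq_iff algebra_simps sum.distrib sum_subtractf sum_distrib_left)

lemma gradient_add_const: "(\<And>x. u x = v x + k) \<Longrightarrow> gradient c u = gradient c v"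
  by (simp add: gradient_def)

lemma laplacian_add_const: "(\<And>x. u x = v x + k) \<Longrightarrow> laplacian c u = laplacian c v"
  by (simp add: laplacian_def fun_eq_iff)

lemma fmc_of_eq_iff: "fmc_of u = fmc_of v \<longleftrightarrow> (\<exists>k. \<forall>x. u x = v x + k)"
  by transfer simp

lemma fmc_of_eq_gradient: "fmc_of u = fmc_of v \<Longrightarrow> gradient c u = gradient c v"
  by (auto simp: fmc_of_eq_iff intro: gradient_add_const)

lemma fmc_of_eq_laplacian: "fmc_of u = fmc_of v \<Longrightarrow> laplacian c u = laplacian c v"
  by (auto simp: fmc_of_eq_iff intro: laplacian_add_const)

lemma fmc_of_cases: obtains u where "w = fmc_of u"
proof -
  have "\<exists>u. w = fmc_of u"
  proof transfer
    show "\<exists>u. \<exists>k. \<forall>x. w x = u x + k" for w :: "'a \<Rightarrow> 'b"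
      by (intro exI[of _ w] exI[of _ 0]) simp
  qed
  then show ?thesis using that by blast
qed

lemma fmc_of_zero: "fmc_of 0 = 0"
  and fmc_of_add: "fmc_of (u + v) = fmc_of u + fmc_of v"
  and fmc_of_diff: "fmc_of (u - v) = fmc_of u - fmc_of v"
  and fmc_of_scale: "fmc_of (fun_scale k u) = fmc_scale k (fmc_of u)"
  by (transfer; rule exI[of _ 0]; simp)+

lemma fmc_diff_of: "fmc_diff (fmc_of u) x y = u x - u y"
  by transfer simp

interpretation fmc: module fmc_scale
  by (rule module_fmc_scale)


context
  fixes c :: "'a \<Rightarrow> 'a \<Rightarrow> real" and o\<^sub>0 :: 'a
  assumes network: "network c"
begin

lemma conductance_nonneg [simp]: "c x y \<ge> 0"
  and conductance_sym: "c x y = c y x"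
  and conductance_self [simp]: "c x x = 0"
  and finite_neighbours [simp]: "finite {y. c x y > 0}"
  and connected: "(x, y) \<in> {(p, q). c p q > 0}\<^sup>*"
  using network unfolding network_def by blast+

lemma conductance_zero: "\<not> c x y > 0 \<Longrightarrow> c x y = 0"
  using conductance_nonneg[of x y] by linarith

lemma sqrt_conductance_mult:
  "of_real (sqrt (c x y / 2)) * of_real (sqrt (c x y / 2)) = (of_real (c x y / 2) :: 'k::rc_field)"
  by (simp flip: of_real_mult)

lemma finite_energy_iff: "finite_energy c u \<longleftrightarrow> gradient c u \<in> vectors ell2"
proof -
  have "(norm (gradient c u e))\<^sup>2 = (1/2) * (case e of (x, y) \<Rightarrow> c x y * (norm (u x - u y))\<^sup>2)" for e
    by (cases e) (simp add: gradient_def norm_mult power_mult_distrib)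
  then show ?thesis
    unfolding finite_energy_def mem_ell2 by (simp only: summable_on_cmult_right')
qed

lemma energy_eq: "energy c (\<lambda>x. conjugate (u x)) v = iprod ell2 (gradient c u) (gradient c v)"
proof -
  have "conjugate (gradient c u e) * gradient c v e
      = (case e of (x, y) \<Rightarrow> of_real (c x y) * ((conjugate (u x) - conjugate (u y)) * (v x - v y)))
        * (1/2)" for e
  proof (cases e)
    case (Pair x y)
    have "conjugate (gradient c u e) * gradient c v e
      = (of_real (sqrt (c x y / 2)) * of_real (sqrt (c x y / 2)))
        * ((conjugate (u x) - conjugate (u y)) * (v x - v y))"
      by (simp add: Pair gradient_def conjugate_dist_mul conjugate_diff mult_ac)
    then show ?thesis by (simp only: sqrt_conductance_mult) (simp add: Pair)
  qed
  then show ?thesis unfolding energy_def ell2_iprod by (simp only: infsum_cmult_left') simp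
qed

lemma energy_space_iprod:
  "iprod (energy_space c) (fmc_of u) (fmc_of v) = iprod ell2 (gradient c u) (gradient c v)"
  unfolding energy_eq [symmetric] by (simp add: energy_space_def) (transfer, rule refl)

lemma mem_energy_space: "fmc_of u \<in> vectors (energy_space c) \<longleftrightarrow> gradient c u \<in> vectors ell2"
  unfolding finite_energy_iff [symmetric] by (simp add: energy_space_def) (transfer, rule refl)

lemma energy_space_norm: "ip_norm (energy_space c) (fmc_of u) = ip_norm ell2 (gradient c u)"
  by (simp add: ip_norm_def energy_space_iprod)

lemma gradient_delta: "gradient c (delta x) \<in> vectors ell2"
proof (rule ell2_finite_support)
  show "finite ({x} \<times> {y. c x y > 0} \<union> {y. c x y > 0} \<times> {x})" by simp
  show "gradient c (delta x) e = 0" if "e \<notin> {x} \<times> {y. c x y > 0} \<union> {y. c x y > 0} \<times> {x}" for e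
    using that conductance_sym[of "fst e" "snd e"]
    by (cases e) (auto simp: gradient_def delta_def dest!: conductance_zero)
qed

text \<open>The inner product with \<open>\<delta>\<^sub>x\<close> in the energy space evaluates the Laplacian at \<open>x\<close>.\<close>

lemma iprod_gradient_delta:
  "iprod ell2 (gradient c (delta x)) (gradient c u) = laplacian c u x"
proof -
  let ?N = "{y. c x y > 0}"
  let ?f = "\<lambda>e. conjugate (gradient c (delta x) e) * gradient c u e"
  have out: "?f (x, y) = of_real (c x y / 2) * (u x - u y)" if "y \<in> ?N" for y
  proof -
    from that have "y \<noteq> x" by auto
    then show ?thesis
      unfolding sqrt_conductance_mult [symmetric]
      by (simp add: gradient_def delta_def mult.assoc)
  qed
  have inn: "?f (y, x) = of_real (c x y / 2) * (u x - u y)" if "y \<in> ?N" for y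
  proof -
    from that have "y \<noteq> x" by auto
    then show ?thesis
      unfolding sqrt_conductance_mult [symmetric]
      by (simp add: gradient_def delta_def conjugate_neg conductance_sym[of y x] algebra_simps)
  qed
  have "(?f has_sum (\<Sum>e\<in>{x} \<times> ?N \<union> ?N \<times> {x}. ?f e)) UNIV"
  proof (rule has_sum_finite_neutralI)
    show "?f e = 0" if "e \<in> UNIV - ({x} \<times> ?N \<union> ?N \<times> {x})" for e
      using that conductance_sym[of "fst e" "snd e"]
      by (cases e) (auto simp: gradient_def delta_def dest!: conductance_zero)
  qed auto
  then have "iprod ell2 (gradient c (delta x)) (gradient c u) = (\<Sum>e\<in>{x} \<times> ?N \<union> ?N \<times> {x}. ?f e)"
    unfolding ell2_iprod by (rule infsumI)
  also have "\<dots> = (\<Sum>e\<in>{x} \<times> ?N. ?f e) + (\<Sum>e\<in>?N \<times> {x}. ?f e)"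
    by (rule sum.union_disjoint) auto
  also have "(\<Sum>e\<in>{x} \<times> ?N. ?f e) = (\<Sum>y\<in>?N. ?f (x, y))"
    by (rule sum.reindex_bij_witness[of _ "\<lambda>y. (x, y)" snd]) auto
  also have "\<dots> = (\<Sum>y\<in>?N. of_real (c x y / 2) * (u x - u y))"
    by (intro sum.cong refl out)
  also have "(\<Sum>e\<in>?N \<times> {x}. ?f e) = (\<Sum>y\<in>?N. ?f (y, x))"
    by (rule sum.reindex_bij_witness[of _ "\<lambda>y. (y, x)" fst]) auto
  also have "\<dots> = (\<Sum>y\<in>?N. of_real (c x y / 2) * (u x - u y))"
    by (intro sum.cong refl inn)
  finally show ?thesis
    by (simp add: laplacian_def flip: sum.distrib)
qed

lemma gradient_zero_imp_const:
  assumes "gradient c u = 0"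
  shows "u x = u y"
  using connected[of x y]
proof (induction rule: rtrancl_induct)
  case (step y z)
  then have "gradient c u (y, z) = 0" "c y z > 0" using assms by auto
  then show ?case using step.IH by (simp add: gradient_def)
qed simp

lemma gradient_eq_imp_fmc_of_eq:
  assumes "gradient c u = gradient c v"
  shows "fmc_of u = fmc_of v"
proof -
  have "gradient c (u - v) = 0" using assms by (simp add: gradient_diff)
  then have "(u - v) x = (u - v) o\<^sub>0" for x by (rule gradient_zero_imp_const)
  then have "u x = v x + (u o\<^sub>0 - v o\<^sub>0)" for x by (simp add: algebra_simps)
  then show ?thesis unfolding fmc_of_eq_iff by blast
qed

lemma gradient_tendsto_edge:
  assumes l: "(\<lambda>n. gradient c (h n) (x, y)) \<longlonglongrightarrow> l" and pos: "c x y > 0"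
  shows "(\<lambda>n. h n x - h n y) \<longlonglongrightarrow> inverse (of_real (sqrt (c x y / 2))) * l"
proof -
  have "inverse (of_real (sqrt (c x y / 2))) * gradient c u (x, y) = u x - u y" for u :: "'a \<Rightarrow> 'b"
    using pos by (simp add: gradient_def)
  moreover have "(\<lambda>n. inverse (of_real (sqrt (c x y / 2))) * gradient c (h n) (x, y))
      \<longlonglongrightarrow> inverse (of_real (sqrt (c x y / 2))) * l"
    by (intro tendsto_mult_left l)
  ultimately show ?thesis by (simp only:)
qed

text \<open>The set of gradients is closed under pointwise convergence, by connectedness.\<close>

lemma gradient_limit:
  assumes r: "\<And>e. (\<lambda>n. gradient c (h n) e) \<longlonglongrightarrow> r e"
  obtains u where "r = gradient c u" "\<And>x. (\<lambda>n. h n x - h n o\<^sub>0) \<longlonglongrightarrow> u x"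
proof -
  have edge: "convergent (\<lambda>n. h n x - h n y)" if "c x y > 0" for x y
    using gradient_tendsto_edge[OF r that] unfolding convergent_def by blast
  have "convergent (\<lambda>n. h n x - h n o\<^sub>0)" for x
    using connected[of x o\<^sub>0]
  proof (induction rule: converse_rtrancl_induct)
    case (step x y)
    then have "convergent (\<lambda>n. (h n x - h n y) + (h n y - h n o\<^sub>0))"
      by (intro convergent_add[OF edge]) auto
    then show ?case by simp
  qed (simp add: convergent_const)
  then obtain u where u: "\<And>x. (\<lambda>n. h n x - h n o\<^sub>0) \<longlonglongrightarrow> u x"
    unfolding convergent_def by metis
  have "r (x, y) = gradient c u (x, y)" for x y
  proof (rule LIMSEQ_unique[OF r])
    have "(\<lambda>n. of_real (sqrt (c x y / 2)) * ((h n x - h n o\<^sub>0) - (h n y - h n o\<^sub>0)))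
        \<longlonglongrightarrow> of_real (sqrt (c x y / 2)) * (u x - u y)"
      by (intro tendsto_intros u)
    then show "(\<lambda>n. gradient c (h n) (x, y)) \<longlonglongrightarrow> gradient c u (x, y)"
      by (simp add: gradient_def)
  qed
  then have "r = gradient c u" by auto
  then show ?thesis using u by (rule that)
qed

lemma laplacian_tendsto:
  assumes "\<And>y. (\<lambda>n. gradient c (h n) (x, y)) \<longlonglongrightarrow> gradient c u (x, y)"
  shows "(\<lambda>n. laplacian c (h n) x) \<longlonglongrightarrow> laplacian c u x"
  unfolding laplacian_def
proof (intro tendsto_sum tendsto_mult_left)
  show "(\<lambda>n. h n x - h n y) \<longlonglongrightarrow> u x - u y" if "y \<in> {y. c x y > 0}" for y
    using gradient_tendsto_edge[OF assms, of y] that by (simp add: gradient_def flip: mult.assoc)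
qed

text \<open>A maximum principle: the modulus of a square-summable function attains its maximum, and
  \<open>(1 + \<Sum>y. c x y) u(x) = \<Sum>y. c x y u(y)\<close> rules out a positive maximum.\<close>

lemma ell2_laplacian_eigenfunction_zero:
  assumes u: "u \<in> vectors ell2" and eq: "\<And>x. u x + laplacian c u x = 0"
  shows "u = 0"
proof (rule ccontr)
  assume "u \<noteq> 0"
  then obtain x\<^sub>0 where x\<^sub>0: "u x\<^sub>0 \<noteq> 0" by (auto simp: fun_eq_iff)
  let ?A = "{x. norm (u x\<^sub>0) \<le> norm (u x)}"
  have fin: "finite ?A"
  proof (rule ccontr)
    assume inf: "infinite ?A"
    obtain m :: nat where m: "(ip_norm ell2 u)\<^sup>2 < m * (norm (u x\<^sub>0))\<^sup>2"
      using reals_Archimedean3[of "(norm (u x\<^sub>0))\<^sup>2"] x\<^sub>0 by auto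
    obtain F where F: "F \<subseteq> ?A" "finite F" "card F = m"
      using infinite_arbitrarily_large[OF inf] by blast
    have "m * (norm (u x\<^sub>0))\<^sup>2 = (\<Sum>x\<in>F. (norm (u x\<^sub>0))\<^sup>2)" using F by simp
    also have "\<dots> \<le> (\<Sum>x\<in>F. (norm (u x))\<^sup>2)"
      using F by (intro sum_mono power_mono) auto
    also have "\<dots> \<le> (ip_norm ell2 u)\<^sup>2" using u F by (intro ell2_finite_sum_le)
    finally show False using m by simp
  qed
  have "Max ((\<lambda>x. norm (u x)) ` ?A) \<in> (\<lambda>x. norm (u x)) ` ?A"
    using fin by (intro Max_in) auto
  then obtain z where z: "z \<in> ?A" "norm (u z) = Max ((\<lambda>x. norm (u x)) ` ?A)" by auto
  have max: "norm (u y) \<le> norm (u z)" for y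
  proof (cases "y \<in> ?A")
    case True
    then show ?thesis unfolding z(2) using fin by (intro Max_ge) auto
  qed (use z(1) in auto)
  define d where "d = (\<Sum>y | c z y > 0. c z y)"
  have d: "d \<ge> 0" unfolding d_def by (intro sum_nonneg) simp
  have "laplacian c u z = of_real d * u z - (\<Sum>y | c z y > 0. of_real (c z y) * u y)"
    by (simp add: laplacian_def d_def right_diff_distrib sum_subtractf sum_distrib_right)
  then have "of_real (1 + d) * u z = (\<Sum>y | c z y > 0. of_real (c z y) * u y)"
    using eq[of z] by (simp add: distrib_right add_diff_eq)
  then have "norm (of_real (1 + d) * u z) = norm (\<Sum>y | c z y > 0. of_real (c z y) * u y)"
    by (rule arg_cong)
  also have "\<dots> \<le> (\<Sum>y | c z y > 0. norm (of_real (c z y) * u y))" by (rule norm_sum)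
  also have "\<dots> \<le> (\<Sum>y | c z y > 0. c z y * norm (u z))"
    by (intro sum_mono) (simp add: norm_mult mult_left_mono max)
  also have "\<dots> = d * norm (u z)" by (simp add: d_def sum_distrib_right)
  finally have "(1 + d) * norm (u z) \<le> d * norm (u z)"
    using d by (simp add: norm_mult del: of_real_add)
  then have "norm (u z) \<le> 0" by (simp add: distrib_right)
  then show False using z(1) x\<^sub>0 by simp
qed


section \<open>Dipoles\<close>

text \<open>The Riesz representative of evaluation is a multiple of the element of least norm in the affine
  subspace on which the evaluation is \<open>1\<close>, which contains \<open>\<delta>\<^sub>x\<close> if \<open>x \<noteq> o\<close>.\<close>

lemma riesz_evaluation:
  obtains v :: "'a \<Rightarrow> 'k::rc_field" where "gradient c v \<in> vectors ell2"
    "\<And>u. gradient c u \<in> vectors ell2 \<Longrightarrow> iprod ell2 (gradient c v) (gradient c u) = u x - u o\<^sub>0"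
proof (cases "x = o\<^sub>0")
  case True
  show ?thesis
    by (rule that[of 0]) (auto simp: ell2_zero ell2_iprod True)
next
  case False
  let ?S = "gradient c ` {u :: 'a \<Rightarrow> 'k. gradient c u \<in> vectors ell2 \<and> u x = u o\<^sub>0}"
  have sub: "module.subspace fun_scale ?S"
  proof (rule fun_scale.subspaceI)
    show "0 \<in> ?S" by (rule image_eqI[of _ _ 0]) (auto simp: ell2_zero)
    show "f + g \<in> ?S" if fg: "f \<in> ?S" "g \<in> ?S" for f g
    proof -
      obtain u v where "f = gradient c u" "gradient c u \<in> vectors ell2" "u x = u o\<^sub>0"
        "g = gradient c v" "gradient c v \<in> vectors ell2" "v x = v o\<^sub>0"
        using fg by auto
      then show ?thesis by (intro image_eqI[of _ _ "u + v"]) (simp_all add: gradient_add ell2_add)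
    qed
    show "fun_scale k f \<in> ?S" if f: "f \<in> ?S" for k f
    proof -
      obtain u where "f = gradient c u" "gradient c u \<in> vectors ell2" "u x = u o\<^sub>0"
        using f by auto
      then show ?thesis
        by (intro image_eqI[of _ _ "fun_scale k u"]) (simp_all add: gradient_scale ell2_scale)
    qed
  qed
  have le: "?S \<subseteq> vectors ell2" by auto
  obtain r s where r: "r \<in> vectors ell2" and s: "\<And>n. s n \<in> ?S"
    and lim: "(\<lambda>n. ip_norm ell2 (gradient c (delta x) - s n - r)) \<longlonglongrightarrow> 0"
    and orth: "\<And>g. g \<in> ?S \<Longrightarrow> iprod ell2 g r = 0"
    using ell2_orthogonal_decomposition[OF sub le gradient_delta[of x]] by blast
  obtain w where w: "\<And>n. s n = gradient c (w n)" "\<And>n. gradient c (w n) \<in> vectors ell2"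
      "\<And>n. w n x = w n o\<^sub>0"
    using s unfolding image_iff by (metis (mono_tags, lifting) mem_Collect_eq)
  define h where "h n = delta x - w n" for n
  have h: "gradient c (h n) = gradient c (delta x) - s n" for n
    by (simp add: h_def gradient_diff w)
  have grad_h: "(\<lambda>n. gradient c (h n) e) \<longlonglongrightarrow> r e" for e
  proof (rule ell2_tendsto_component[of "\<lambda>n. gradient c (h n)" r])
    show "gradient c (h n) \<in> vectors ell2" for n
      unfolding h w(1) by (intro ell2_diff gradient_delta w(2))
    show "(\<lambda>n. ip_norm ell2 (gradient c (h n) - r)) \<longlonglongrightarrow> 0"
      using lim by (simp only: h)
  qed (rule r)
  obtain u where u: "r = gradient c u" "\<And>y. (\<lambda>n. h n y - h n o\<^sub>0) \<longlonglongrightarrow> u y"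
    using gradient_limit[OF grad_h] by blast
  have "u x = 1"
  proof (rule LIMSEQ_unique[OF u(2)])
    show "(\<lambda>n. h n x - h n o\<^sub>0) \<longlonglongrightarrow> 1"
      using False w(3) by (simp add: h_def delta_def)
  qed
  moreover have "u o\<^sub>0 = 0"
    using LIMSEQ_unique[OF u(2)[of o\<^sub>0]] by simp
  ultimately have ux: "u x - u o\<^sub>0 = 1" by simp
  have uL: "gradient c u \<in> vectors ell2" using r u by simp
  let ?q = "(ip_norm ell2 (gradient c u))\<^sup>2"
  have "?q \<noteq> 0"
    using ell2_norm_zero_imp[OF uL] gradient_zero_imp_const[of u x o\<^sub>0] ux by auto
  have eq: "iprod ell2 (gradient c u) (gradient c f) = (f x - f o\<^sub>0) * of_real ?q"
    if f: "gradient c f \<in> vectors ell2" for f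
  proof -
    let ?k = "f x - f o\<^sub>0"
    let ?g = "f - fun_scale ?k u"
    have g: "gradient c ?g = gradient c f - fun_scale ?k (gradient c u)"
      by (simp add: gradient_diff gradient_scale)
    then have gL: "gradient c ?g \<in> vectors ell2" by (simp add: f uL ell2_diff ell2_scale)
    have "?g x - ?g o\<^sub>0 = ?k - ?k * (u x - u o\<^sub>0)" by (simp add: algebra_simps)
    then have "?g x = ?g o\<^sub>0" by (simp add: ux)
    then have "iprod ell2 (gradient c ?g) r = 0" using gL by (intro orth imageI CollectI conjI)
    then have "iprod ell2 (gradient c u) (gradient c ?g) = 0"
      using ell2_iprod_conjugate[OF gL uL] by (simp add: u(1))
    then show ?thesis
      unfolding g using f uL
      by (simp add: ell2_iprod_diff_right ell2_scale ell2_iprod_scale_right ell2_iprod_self_norm)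
  qed
  show ?thesis
  proof (rule that[of "fun_scale (of_real (1 / ?q)) u"])
    show "gradient c (fun_scale (of_real (1 / ?q)) u) \<in> vectors ell2"
      by (simp only: gradient_scale ell2_scale uL)
    show "iprod ell2 (gradient c (fun_scale (of_real (1 / ?q)) u)) (gradient c f) = f x - f o\<^sub>0"
      if "gradient c f \<in> vectors ell2" for f
      unfolding gradient_scale ell2_iprod_scale_left conjugate_of_real eq[OF that]
      using \<open>?q \<noteq> 0\<close> by simp
  qed
qed

lemma energy_kernel_representative:
  obtains v :: "'a \<Rightarrow> 'k::rc_field" where "energy_kernel c o\<^sub>0 x = fmc_of v"
    "gradient c v \<in> vectors ell2"
    "\<And>u. gradient c u \<in> vectors ell2 \<Longrightarrow> iprod ell2 (gradient c v) (gradient c u) = u x - u o\<^sub>0"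
proof -
  obtain v :: "'a \<Rightarrow> 'k" where v: "gradient c v \<in> vectors ell2"
    "\<And>u. gradient c u \<in> vectors ell2 \<Longrightarrow> iprod ell2 (gradient c v) (gradient c u) = u x - u o\<^sub>0"
    using riesz_evaluation by blast
  have "energy_kernel c o\<^sub>0 x = fmc_of v"
    unfolding energy_kernel_def
  proof (rule the_equality)
    have "iprod (energy_space c) (fmc_of v) u = fmc_diff u x o\<^sub>0"
      if "u \<in> vectors (energy_space c)" for u
      using that v(2)
      by (cases u rule: fmc_of_cases) (simp add: mem_energy_space energy_space_iprod fmc_diff_of)
    then show "fmc_of v \<in> vectors (energy_space c) \<and>
      (\<forall>u\<in>vectors (energy_space c). iprod (energy_space c) (fmc_of v) u = fmc_diff u x o\<^sub>0)"
      using v(1) by (simp add: mem_energy_space)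
  next
    fix w :: "('a, 'k) fun_mod_const"
    assume w: "w \<in> vectors (energy_space c) \<and>
      (\<forall>u\<in>vectors (energy_space c). iprod (energy_space c) w u = fmc_diff u x o\<^sub>0)"
    obtain w' where w': "w = fmc_of w'" by (rule fmc_of_cases)
    have w'L: "gradient c w' \<in> vectors ell2" using w by (simp add: w' mem_energy_space)
    let ?d = "gradient c w' - gradient c v"
    have d: "?d = gradient c (w' - v)" by (simp add: gradient_diff)
    have dL: "?d \<in> vectors ell2" using w'L v(1) by (rule ell2_diff)
    have "iprod (energy_space c) w (fmc_of (w' - v)) = fmc_diff (fmc_of (w' - v)) x o\<^sub>0"
      using w dL by (simp add: mem_energy_space d)
    then have "iprod ell2 (gradient c w') ?d = iprod ell2 (gradient c v) ?d"
      using v(2)[of "w' - v"] dL by (simp add: w' energy_space_iprod fmc_diff_of d)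
    then have "iprod ell2 ?d ?d = 0"
      by (simp add: ell2_iprod_diff_left w'L v(1) dL)
    then have "ip_norm ell2 ?d = 0" by (simp add: ip_norm_def)
    then have "?d = 0" by (rule ell2_norm_zero_imp[OF dL])
    then show "w = fmc_of v" unfolding w' by (intro gradient_eq_imp_fmc_of_eq) simp
  qed
  then show ?thesis using v by (rule that)
qed

lemma laplacian_dipole:
  assumes v: "gradient c v \<in> vectors ell2"
    "\<And>u. gradient c u \<in> vectors ell2 \<Longrightarrow> iprod ell2 (gradient c v) (gradient c u) = u x - u o\<^sub>0"
  shows "laplacian c v = delta x - delta o\<^sub>0"
proof
  fix y
  have "laplacian c v y = conjugate (iprod ell2 (gradient c v) (gradient c (delta y)))"
    by (simp add: iprod_gradient_delta [symmetric] ell2_iprod_conjugate v(1) gradient_delta)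
  also have "\<dots> = (delta x - delta o\<^sub>0) y"
    by (simp add: v(2) gradient_delta conjugate_diff) (simp add: delta_def)
  finally show "laplacian c v y = (delta x - delta o\<^sub>0) y" .
qed

lemma ell2_iprod_laplacian_dipole:
  assumes v: "gradient c v \<in> vectors ell2"
    "\<And>u. gradient c u \<in> vectors ell2 \<Longrightarrow> iprod ell2 (gradient c v) (gradient c u) = u x - u o\<^sub>0"
    and f: "f \<in> vectors ell2"
  shows "iprod ell2 (laplacian c v) f = f x - f o\<^sub>0"
  using f by (simp add: laplacian_dipole[OF v] ell2_iprod_diff_left delta_in_ell2 ell2_iprod_delta)

text \<open>Subspaces of classes modulo constants are handled through subspaces of representing functions.\<close>

lemma dipole_span_representative:
  assumes A: "module.subspace fun_scale A" and ker: "\<And>x. \<exists>v\<in>A. energy_kernel c o\<^sub>0 x = fmc_of v"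
    and w: "fmc_of w \<in> module.span fmc_scale (range (energy_kernel c o\<^sub>0))"
  obtains v where "v \<in> A" "fmc_of w = fmc_of v"
proof -
  have "module.span fmc_scale (range (energy_kernel c o\<^sub>0)) \<subseteq> fmc_of ` A"
  proof (rule fmc.span_minimal)
    show "range (energy_kernel c o\<^sub>0) \<subseteq> fmc_of ` A" using ker by auto
    show "module.subspace fmc_scale (fmc_of ` A)"
      using A
      by (auto simp: fmc.subspace_def fun_scale.subspace_def simp flip: fmc_of_zero fmc_of_add fmc_of_scale)
  qed
  then show ?thesis using w that by auto
qed

text \<open>The Gauss-Green formula on the span of the dipoles: \<open>\<langle>\<Delta>w, f\<rangle> = \<langle>w, f\<rangle>\<close>, with the inner product of
  \<open>\<ell>\<^sup>2\<close> on the left and that of the energy space on the right.\<close>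

lemma dipole_span_laplacian:
  fixes w :: "'a \<Rightarrow> 'k::rc_field"
  assumes w: "fmc_of w \<in> module.span fmc_scale (range (energy_kernel c o\<^sub>0))"
  shows "gradient c w \<in> vectors ell2" "laplacian c w \<in> vectors ell2"
    and "f \<in> vectors ell2 \<Longrightarrow> gradient c f \<in> vectors ell2 \<Longrightarrow>
           iprod ell2 (laplacian c w) f = iprod ell2 (gradient c w) (gradient c f)"
proof -
  define A :: "('a \<Rightarrow> 'k) set" where
    "A = {v. gradient c v \<in> vectors ell2 \<and> laplacian c v \<in> vectors ell2 \<and>
       (\<forall>f. f \<in> vectors ell2 \<longrightarrow> gradient c f \<in> vectors ell2 \<longrightarrow>
           iprod ell2 (laplacian c v) f = iprod ell2 (gradient c v) (gradient c f))}"
  have "module.subspace fun_scale A"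
    unfolding fun_scale.subspace_def A_def
    by (auto simp: gradient_add laplacian_add gradient_scale laplacian_scale ell2_zero ell2_add
        ell2_scale ell2_iprod_add_left ell2_iprod_scale_left)
       (simp_all add: ell2_iprod)
  moreover have "\<exists>v\<in>A. energy_kernel c o\<^sub>0 x = fmc_of v" for x
  proof -
    obtain v :: "'a \<Rightarrow> 'k" where v: "energy_kernel c o\<^sub>0 x = fmc_of v" "gradient c v \<in> vectors ell2"
      "\<And>u. gradient c u \<in> vectors ell2 \<Longrightarrow> iprod ell2 (gradient c v) (gradient c u) = u x - u o\<^sub>0"
      using energy_kernel_representative by blast
    have "v \<in> A"
      unfolding A_def
      using v(2) laplacian_dipole[OF v(2,3)] ell2_iprod_laplacian_dipole[OF v(2,3)]
      by (auto simp: v(3) ell2_diff delta_in_ell2)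
    then show ?thesis using v(1) by blast
  qed
  ultimately obtain v where v: "v \<in> A" "fmc_of w = fmc_of v"
    using dipole_span_representative[OF _ _ w] by blast
  then have "gradient c w = gradient c v" "laplacian c w = laplacian c v"
    by (auto intro: fmc_of_eq_gradient fmc_of_eq_laplacian)
  then show "gradient c w \<in> vectors ell2" "laplacian c w \<in> vectors ell2"
    "f \<in> vectors ell2 \<Longrightarrow> gradient c f \<in> vectors ell2 \<Longrightarrow>
           iprod ell2 (laplacian c w) f = iprod ell2 (gradient c w) (gradient c f)"
    using v(1) unfolding A_def by auto
qed

text \<open>On the span of the \<open>\<delta>\<^sub>x\<close> all sums are finite, hence the Gauss-Green formula holds against every
  function in the domain of the maximal Laplacian.\<close>

lemma delta_span:
  fixes f :: "'a \<Rightarrow> 'k::rc_field"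
  assumes f: "f \<in> module.span fun_scale (range delta)"
  shows "f \<in> vectors ell2" "gradient c f \<in> vectors ell2"
    and "gradient c w \<in> vectors ell2 \<Longrightarrow> laplacian c w \<in> vectors ell2 \<Longrightarrow>
           iprod ell2 (gradient c f) (gradient c w) = iprod ell2 f (laplacian c w)"
proof -
  define A :: "('a \<Rightarrow> 'k) set" where
    "A = {f. f \<in> vectors ell2 \<and> gradient c f \<in> vectors ell2 \<and>
       (\<forall>w. gradient c w \<in> vectors ell2 \<longrightarrow> laplacian c w \<in> vectors ell2 \<longrightarrow>
           iprod ell2 (gradient c f) (gradient c w) = iprod ell2 f (laplacian c w))}"
  have "module.span fun_scale (range delta) \<subseteq> A"
  proof (rule fun_scale.span_minimal)
    show "range delta \<subseteq> A"
      by (auto simp: A_def delta_in_ell2 gradient_delta iprod_gradient_delta ell2_iprod_delta)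
    show "module.subspace fun_scale A"
      unfolding fun_scale.subspace_def A_def
      by (auto simp: gradient_add gradient_scale ell2_zero ell2_add
          ell2_scale ell2_iprod_add_left ell2_iprod_scale_left)
         (simp_all add: ell2_iprod)
  qed
  then show "f \<in> vectors ell2" "gradient c f \<in> vectors ell2"
    "gradient c w \<in> vectors ell2 \<Longrightarrow> laplacian c w \<in> vectors ell2 \<Longrightarrow>
           iprod ell2 (gradient c f) (gradient c w) = iprod ell2 f (laplacian c w)"
    using f unfolding A_def by auto
qed


section \<open>The closures and adjoints\<close>

lemma closure_J_le:
  assumes "(f, w) \<in> op_closure ell2 (energy_space c) (J_op :: (('a \<Rightarrow> 'k::rc_field) \<times> _) set)"
  shows "f \<in> vectors ell2 \<and> gradient c f \<in> vectors ell2 \<and> w = fmc_of f"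
proof -
  obtain s t where f: "f \<in> vectors ell2" and w: "w \<in> vectors (energy_space c)"
    and st: "\<And>n. (s n, t n) \<in> (J_op :: (('a \<Rightarrow> 'k) \<times> _) set)"
    and s: "(\<lambda>n. ip_norm ell2 (s n - f)) \<longlonglongrightarrow> 0"
    and t: "(\<lambda>n. ip_norm (energy_space c) (t n - w)) \<longlonglongrightarrow> 0"
    using assms unfolding op_closure_def by blast
  obtain g where g: "w = fmc_of g" by (rule fmc_of_cases)
  have gL: "gradient c g \<in> vectors ell2" using w by (simp add: g mem_energy_space)
  have sp: "s n \<in> module.span fun_scale (range delta)" and t_eq: "t n = fmc_of (s n)" for n
    using st[of n] by (auto simp: J_op_def)
  have "(\<lambda>n. s n x) \<longlonglongrightarrow> f x" for x
    using delta_span(1)[OF sp] f s by (rule ell2_tendsto_component)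
  then have "(\<lambda>n. gradient c (s n) (x, y)) \<longlonglongrightarrow> gradient c f (x, y)" for x y
    unfolding gradient_def by (simp, intro tendsto_intros)
  moreover have "(\<lambda>n. gradient c (s n) (x, y)) \<longlonglongrightarrow> gradient c g (x, y)" for x y
    using delta_span(2)[OF sp] gL
  proof (rule ell2_tendsto_component)
    show "(\<lambda>n. ip_norm ell2 (gradient c (s n) - gradient c g)) \<longlonglongrightarrow> 0"
      using t by (simp add: t_eq g energy_space_norm gradient_diff flip: fmc_of_diff)
  qed
  ultimately have "gradient c f = gradient c g"
    by (intro ext) (metis LIMSEQ_unique surj_pair)
  then show ?thesis using f gL by (auto simp: g intro: gradient_eq_imp_fmc_of_eq)
qed

text \<open>The residual of \<open>(f, f)\<close> after projection to the closure of the graph of \<open>J\<close> is again a pair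
  \<open>(u, u)\<close>, and orthogonality to the graph of \<open>J\<close> means that \<open>u + \<Delta>u = 0\<close>.\<close>

lemma closure_J_ge:
  fixes f :: "'a \<Rightarrow> 'k::rc_field"
  assumes f: "f \<in> vectors ell2" "gradient c f \<in> vectors ell2"
  shows "(f, fmc_of f) \<in> op_closure ell2 (energy_space c) J_op"
proof -
  define graph :: "('a \<Rightarrow> 'k) \<Rightarrow> 'a + 'a \<times> 'a \<Rightarrow> 'k" where "graph u = case_sum u (gradient c u)" for u
  let ?D = "module.span fun_scale (range (delta :: 'a \<Rightarrow> 'a \<Rightarrow> 'k))"
  have graph_add: "graph (u + v) = graph u + graph v"
    and graph_scale: "graph (fun_scale k u) = fun_scale k (graph u)"
    and graph_diff: "graph (u - v) = graph u - graph v"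
    and graph_zero: "graph 0 = 0" for u v k
    by (auto simp: graph_def fun_eq_iff gradient_add gradient_scale gradient_diff split: sum.split)
  have graph_ell2: "graph u \<in> vectors ell2" if "u \<in> ?D" for u
    using delta_span[OF that] by (simp add: graph_def ell2_case_sum)
  have sub: "module.subspace fun_scale (graph ` ?D)"
    using fun_scale.subspace_span[of "range delta"]
    by (auto simp: fun_scale.subspace_def simp flip: graph_zero graph_add graph_scale)
  have le: "graph ` ?D \<subseteq> vectors ell2" using graph_ell2 by auto
  have fL: "graph f \<in> vectors ell2" by (simp add: graph_def ell2_case_sum f)
  obtain r s where r: "r \<in> vectors ell2" and s: "\<And>n. s n \<in> graph ` ?D"
    and lim: "(\<lambda>n. ip_norm ell2 (graph f - s n - r)) \<longlonglongrightarrow> 0"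
    and orth: "\<And>g. g \<in> graph ` ?D \<Longrightarrow> iprod ell2 g r = 0"
    using ell2_orthogonal_decomposition[OF sub le fL] by blast
  obtain g where g: "\<And>n. s n = graph (g n)" "\<And>n. g n \<in> ?D"
    using s unfolding image_iff by metis
  have h: "graph f - s n = graph (f - g n)" for n by (simp add: graph_diff g)
  have hL: "graph (f - g n) \<in> vectors ell2" for n
    unfolding graph_diff by (intro ell2_diff fL graph_ell2 g)
  define u where "u x = r (Inl x)" for x
  have comp: "(\<lambda>n. graph (f - g n) e) \<longlonglongrightarrow> r e" for e
    using hL r lim unfolding h by (rule ell2_tendsto_component)
  have "(\<lambda>n. (f - g n) x) \<longlonglongrightarrow> u x" for x
    using comp[of "Inl x"] by (simp add: graph_def u_def)
  then have "(\<lambda>n. gradient c (f - g n) (x, y)) \<longlonglongrightarrow> gradient c u (x, y)" for x y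
    unfolding gradient_def prod.case by (intro tendsto_intros)
  moreover have "(\<lambda>n. gradient c (f - g n) (x, y)) \<longlonglongrightarrow> r (Inr (x, y))" for x y
    using comp[of "Inr (x, y)"] by (simp add: graph_def)
  ultimately have "r (Inr (x, y)) = gradient c u (x, y)" for x y
    using LIMSEQ_unique by blast
  then have r_eq: "r = graph u"
    by (auto simp: graph_def u_def fun_eq_iff split: sum.split)
  then have u: "u \<in> vectors ell2" "gradient c u \<in> vectors ell2"
    using r by (simp_all add: graph_def ell2_case_sum)
  have "u x + laplacian c u x = 0" for x
  proof -
    have "iprod ell2 (graph (delta x)) (graph u) = 0"
      using orth[of "graph (delta x)"] r_eq by (auto intro: fun_scale.span_base)
    then show ?thesis
      by (simp add: graph_def ell2_iprod_case_sum delta_in_ell2 gradient_delta u ell2_iprod_delta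
          iprod_gradient_delta)
  qed
  with u(1) have "u = 0" by (rule ell2_laplacian_eigenfunction_zero)
  then have lim0: "(\<lambda>n. ip_norm ell2 (graph (f - g n))) \<longlonglongrightarrow> 0"
    using lim by (simp add: h r_eq graph_zero)
  have dL: "f - g n \<in> vectors ell2" "gradient c (f - g n) \<in> vectors ell2" for n
    using hL[of n] by (simp_all add: graph_def ell2_case_sum)
  have "(\<lambda>n. ip_norm ell2 (f - g n)) \<longlonglongrightarrow> 0"
    by (rule tendsto_sandwich[OF _ _ tendsto_const lim0])
       (simp_all add: graph_def ell2_norm_case_sum dL)
  then have "(\<lambda>n. ip_norm ell2 (g n - f)) \<longlonglongrightarrow> 0" by (simp add: ell2_norm_minus_commute)
  moreover have "(\<lambda>n. ip_norm ell2 (gradient c (f - g n))) \<longlonglongrightarrow> 0"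
    by (rule tendsto_sandwich[OF _ _ tendsto_const lim0])
       (simp_all add: graph_def ell2_norm_case_sum dL)
  then have "(\<lambda>n. ip_norm (energy_space c) (fmc_of (g n) - fmc_of f)) \<longlonglongrightarrow> 0"
    by (simp add: ell2_norm_minus_commute[of "gradient c f"] energy_space_norm gradient_diff
        flip: fmc_of_diff)
  moreover have "(g n, fmc_of (g n)) \<in> J_op" for n
    using g(2) by (auto simp: J_op_def)
  ultimately show ?thesis
    unfolding op_closure_def mem_Collect_eq prod.case mem_energy_space
    using f by (intro conjI exI[of _ g] exI[of _ "\<lambda>n. fmc_of (g n)"] allI) simp_all
qed

lemma closure_J:
  "op_closure ell2 (energy_space c) (J_op :: (('a \<Rightarrow> 'k::rc_field) \<times> _) set)
     = {(f, fmc_of f) | f. f \<in> vectors ell2 \<and> gradient c f \<in> vectors ell2}"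
proof (rule equalityI; rule subrelI)
  fix f :: "'a \<Rightarrow> 'k" and w
  assume "(f, w) \<in> op_closure ell2 (energy_space c) J_op"
  from closure_J_le[OF this]
  show "(f, w) \<in> {(f, fmc_of f) | f. f \<in> vectors ell2 \<and> gradient c f \<in> vectors ell2}" by blast
next
  fix f :: "'a \<Rightarrow> 'k" and w
  assume "(f, w) \<in> {(f, fmc_of f) | f. f \<in> vectors ell2 \<and> gradient c f \<in> vectors ell2}"
  then have "f \<in> vectors ell2" "gradient c f \<in> vectors ell2" "w = fmc_of f" by blast+
  then show "(f, w) \<in> op_closure ell2 (energy_space c) J_op" by (simp only: closure_J_ge)
qed

lemma M_op_eq:
  "M_op c o\<^sub>0 = {(fmc_of v, laplacian c v) | v.
     fmc_of v \<in> module.span fmc_scale (range (energy_kernel c o\<^sub>0))}"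
proof -
  have eq: "(\<lambda>x. iprod (energy_space c) (fmc_of (delta x)) (fmc_of v)) = laplacian c v"
    for v :: "'a \<Rightarrow> 'b"
    by (simp add: energy_space_iprod iprod_gradient_delta)
  show ?thesis
  proof (intro equalityI subsetI)
    fix p :: "('a, 'b) fun_mod_const \<times> ('a \<Rightarrow> 'b)" assume "p \<in> M_op c o\<^sub>0"
    then obtain u where u: "p = (u, \<lambda>x. iprod (energy_space c) (fmc_of (delta x)) u)"
      "u \<in> module.span fmc_scale (range (energy_kernel c o\<^sub>0))"
      unfolding M_op_def by blast
    obtain v where "u = fmc_of v" by (rule fmc_of_cases)
    with u show "p \<in> {(fmc_of v, laplacian c v) | v.
        fmc_of v \<in> module.span fmc_scale (range (energy_kernel c o\<^sub>0))}"
      by (simp only: eq) blast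
  qed (auto simp: M_op_def eq)
qed

lemma adjoint_M:
  "op_adjoint (energy_space c) ell2 (M_op c o\<^sub>0 :: (_ \<times> ('a \<Rightarrow> 'k::rc_field)) set)
     = {(f, fmc_of f) | f. f \<in> vectors ell2 \<and> gradient c f \<in> vectors ell2}"
proof (intro equalityI subsetI)
  fix p assume "p \<in> op_adjoint (energy_space c) ell2 (M_op c o\<^sub>0 :: (_ \<times> ('a \<Rightarrow> 'k)) set)"
  then obtain f w where p: "p = (f, w)" and f: "f \<in> vectors ell2" and w: "w \<in> vectors (energy_space c)"
    and adj: "\<And>x y. (x, y) \<in> (M_op c o\<^sub>0 :: (_ \<times> ('a \<Rightarrow> 'k)) set) \<Longrightarrow>
      iprod ell2 y f = iprod (energy_space c) x w"
    unfolding op_adjoint_def by blast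
  obtain g where g: "w = fmc_of g" by (rule fmc_of_cases)
  have gL: "gradient c g \<in> vectors ell2" using w by (simp add: g mem_energy_space)
  have "f x = g x + (f o\<^sub>0 - g o\<^sub>0)" for x
  proof -
    obtain v :: "'a \<Rightarrow> 'k" where v: "energy_kernel c o\<^sub>0 x = fmc_of v" "gradient c v \<in> vectors ell2"
      "\<And>u. gradient c u \<in> vectors ell2 \<Longrightarrow> iprod ell2 (gradient c v) (gradient c u) = u x - u o\<^sub>0"
      using energy_kernel_representative by blast
    have "fmc_of v \<in> module.span fmc_scale (range (energy_kernel c o\<^sub>0))"
      unfolding v(1)[symmetric] by (intro fmc.span_base) simp
    then have "(fmc_of v, laplacian c v) \<in> M_op c o\<^sub>0" unfolding M_op_eq by blast
    then have "iprod ell2 (laplacian c v) f = iprod (energy_space c) (fmc_of v) w" by (rule adj)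
    then have "f x - f o\<^sub>0 = g x - g o\<^sub>0"
      by (simp add: ell2_iprod_laplacian_dipole[OF v(2,3) f] g energy_space_iprod v(3)[OF gL])
    then show ?thesis by (simp add: algebra_simps)
  qed
  then have "fmc_of f = w" unfolding g fmc_of_eq_iff by blast
  moreover from this have "gradient c f \<in> vectors ell2" using w mem_energy_space by blast
  ultimately show "p \<in> {(f, fmc_of f) | f. f \<in> vectors ell2 \<and> gradient c f \<in> vectors ell2}"
    using f by (auto simp: p)
next
  fix p assume "p \<in> {(f :: 'a \<Rightarrow> 'k, fmc_of f) | f. f \<in> vectors ell2 \<and> gradient c f \<in> vectors ell2}"
  then show "p \<in> op_adjoint (energy_space c) ell2 (M_op c o\<^sub>0 :: (_ \<times> ('a \<Rightarrow> 'k)) set)"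
    by (auto simp: op_adjoint_def M_op_eq mem_energy_space energy_space_iprod dipole_span_laplacian)
qed

lemma adjoint_J:
  "op_adjoint ell2 (energy_space c) (J_op :: (('a \<Rightarrow> 'k::rc_field) \<times> _) set)
     = {(fmc_of w, laplacian c w) | w. gradient c w \<in> vectors ell2 \<and> laplacian c w \<in> vectors ell2}"
proof (intro equalityI subsetI)
  fix p assume "p \<in> op_adjoint ell2 (energy_space c) (J_op :: (('a \<Rightarrow> 'k) \<times> _) set)"
  then obtain w u where p: "p = (w, u)" and u: "u \<in> vectors ell2" and w: "w \<in> vectors (energy_space c)"
    and adj: "\<And>x y. (x, y) \<in> (J_op :: (('a \<Rightarrow> 'k) \<times> _) set) \<Longrightarrow>
      iprod (energy_space c) y w = iprod ell2 x u"
    unfolding op_adjoint_def by blast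
  obtain g where g: "w = fmc_of g" by (rule fmc_of_cases)
  have "laplacian c g x = u x" for x
  proof -
    have "(delta x, fmc_of (delta x)) \<in> (J_op :: (('a \<Rightarrow> 'k) \<times> _) set)"
      unfolding J_op_def by (auto intro: fun_scale.span_base)
    then have "iprod (energy_space c) (fmc_of (delta x)) w = iprod ell2 (delta x) u" by (rule adj)
    then show ?thesis by (simp add: g energy_space_iprod iprod_gradient_delta ell2_iprod_delta)
  qed
  then have "laplacian c g = u" by auto
  then show "p \<in> {(fmc_of w, laplacian c w) | w.
      gradient c w \<in> vectors ell2 \<and> laplacian c w \<in> vectors ell2}"
    using u w by (auto simp: p g mem_energy_space)
next
  fix p assume "p \<in> {(fmc_of w, laplacian c w :: 'a \<Rightarrow> 'k) | w.
      gradient c w \<in> vectors ell2 \<and> laplacian c w \<in> vectors ell2}"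
  then show "p \<in> op_adjoint ell2 (energy_space c) (J_op :: (('a \<Rightarrow> 'k) \<times> _) set)"
    by (auto simp: op_adjoint_def J_op_def mem_energy_space energy_space_iprod delta_span)
qed

lemma closure_M_le:
  assumes "(w, u) \<in> op_closure (energy_space c) ell2 (M_op c o\<^sub>0 :: (_ \<times> ('a \<Rightarrow> 'k::rc_field)) set)"
  shows "\<exists>g. w = fmc_of g \<and> u = laplacian c g \<and> gradient c g \<in> vectors ell2
     \<and> laplacian c g \<in> vectors ell2"
proof -
  obtain s t where u: "u \<in> vectors ell2" and w: "w \<in> vectors (energy_space c)"
    and st: "\<And>n. (s n, t n) \<in> (M_op c o\<^sub>0 :: (_ \<times> ('a \<Rightarrow> 'k)) set)"
    and s: "(\<lambda>n. ip_norm (energy_space c) (s n - w)) \<longlonglongrightarrow> 0"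
    and t: "(\<lambda>n. ip_norm ell2 (t n - u)) \<longlonglongrightarrow> 0"
    using assms unfolding op_closure_def by blast
  obtain g where g: "w = fmc_of g" by (rule fmc_of_cases)
  have gL: "gradient c g \<in> vectors ell2" using w by (simp add: g mem_energy_space)
  have "\<exists>v. s n = fmc_of v \<and> t n = laplacian c v \<and>
      fmc_of v \<in> module.span fmc_scale (range (energy_kernel c o\<^sub>0))" for n
    using st[of n] unfolding M_op_eq by auto
  then obtain v where v: "\<And>n. s n = fmc_of (v n)" "\<And>n. t n = laplacian c (v n)"
      "\<And>n. fmc_of (v n) \<in> module.span fmc_scale (range (energy_kernel c o\<^sub>0))"
    by metis
  have "(\<lambda>n. laplacian c (v n) x) \<longlonglongrightarrow> u x" for x
    using dipole_span_laplacian(2)[OF v(3)] u t unfolding v(2) by (rule ell2_tendsto_component)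
  moreover have "(\<lambda>n. laplacian c (v n) x) \<longlonglongrightarrow> laplacian c g x" for x
  proof (rule laplacian_tendsto)
    show "(\<lambda>n. gradient c (v n) (x, y)) \<longlonglongrightarrow> gradient c g (x, y)" for y
      using dipole_span_laplacian(1)[OF v(3)] gL
    proof (rule ell2_tendsto_component)
      show "(\<lambda>n. ip_norm ell2 (gradient c (v n) - gradient c g)) \<longlonglongrightarrow> 0"
        using s by (simp add: v g energy_space_norm gradient_diff flip: fmc_of_diff)
    qed
  qed
  ultimately have "u = laplacian c g" by (auto intro: LIMSEQ_unique)
  then show ?thesis using g gL u by blast
qed

text \<open>The residual of \<open>(w, \<Delta>w)\<close> after projection to the closure of the graph of \<open>M\<close> is again a pair
  \<open>(k, \<Delta>k)\<close>, and orthogonality to the dipoles means that \<open>k + \<Delta>k\<close> is constant.  Hence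
  \<open>u = \<Delta>k\<close> satisfies \<open>u + \<Delta>u = 0\<close>.\<close>

lemma closure_M_ge:
  fixes w :: "'a \<Rightarrow> 'k::rc_field"
  assumes w: "gradient c w \<in> vectors ell2" "laplacian c w \<in> vectors ell2"
  shows "(fmc_of w, laplacian c w) \<in> op_closure (energy_space c) ell2 (M_op c o\<^sub>0)"
proof -
  define graph :: "('a \<Rightarrow> 'k) \<Rightarrow> 'a + 'a \<times> 'a \<Rightarrow> 'k"
    where "graph u = case_sum (laplacian c u) (gradient c u)" for u
  let ?D = "{v :: 'a \<Rightarrow> 'k. fmc_of v \<in> module.span fmc_scale (range (energy_kernel c o\<^sub>0))}"
  have graph_add: "graph (u + v) = graph u + graph v"
    and graph_scale: "graph (fun_scale k u) = fun_scale k (graph u)"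
    and graph_diff: "graph (u - v) = graph u - graph v"
    and graph_zero: "graph 0 = 0" for u v k
    by (auto simp: graph_def fun_eq_iff gradient_add gradient_scale gradient_diff
        laplacian_add laplacian_scale laplacian_diff split: sum.split)
  have graph_ell2: "graph u \<in> vectors ell2" if "u \<in> ?D" for u
    using that dipole_span_laplacian[of u] by (simp add: graph_def ell2_case_sum)
  have "module.subspace fun_scale ?D"
    using fmc.subspace_span[of "range (energy_kernel c o\<^sub>0)"]
    by (auto simp: fun_scale.subspace_def fmc.subspace_def fmc_of_add fmc_of_scale fmc_of_zero)
  then have sub: "module.subspace fun_scale (graph ` ?D)"
    by (auto simp: fun_scale.subspace_def simp flip: graph_zero graph_add graph_scale)
  have le: "graph ` ?D \<subseteq> vectors ell2" using graph_ell2 by auto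
  have wL: "graph w \<in> vectors ell2" by (simp add: graph_def ell2_case_sum w)
  obtain r s where r: "r \<in> vectors ell2" and s: "\<And>n. s n \<in> graph ` ?D"
    and lim: "(\<lambda>n. ip_norm ell2 (graph w - s n - r)) \<longlonglongrightarrow> 0"
    and orth: "\<And>g. g \<in> graph ` ?D \<Longrightarrow> iprod ell2 g r = 0"
    using ell2_orthogonal_decomposition[OF sub le wL] by blast
  obtain g where g: "\<And>n. s n = graph (g n)" "\<And>n. g n \<in> ?D"
    using s unfolding image_iff by metis
  have h: "graph w - s n = graph (w - g n)" for n by (simp add: graph_diff g)
  have hL: "graph (w - g n) \<in> vectors ell2" for n
    unfolding graph_diff by (intro ell2_diff wL graph_ell2 g)
  have comp: "(\<lambda>n. graph (w - g n) e) \<longlonglongrightarrow> r e" for e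
    using hL r lim unfolding h by (rule ell2_tendsto_component)
  have grad_lim: "(\<lambda>n. gradient c (w - g n) e) \<longlonglongrightarrow> r (Inr e)" for e
    using comp[of "Inr e"] by (simp add: graph_def)
  obtain k where k: "(\<lambda>e. r (Inr e)) = gradient c k"
    using gradient_limit[OF grad_lim] by blast
  have k': "r (Inr e) = gradient c k e" for e using fun_cong[OF k] .
  have "r (Inl x) = laplacian c k x" for x
  proof (rule LIMSEQ_unique)
    show "(\<lambda>n. laplacian c (w - g n) x) \<longlonglongrightarrow> r (Inl x)"
      using comp[of "Inl x"] by (simp add: graph_def)
    show "(\<lambda>n. laplacian c (w - g n) x) \<longlonglongrightarrow> laplacian c k x"
      using comp[of "Inr (x, _)"] by (intro laplacian_tendsto) (simp add: graph_def k')
  qed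
  then have r_eq: "r = graph k"
    by (auto simp: graph_def k' fun_eq_iff split: sum.split)
  then have kL: "laplacian c k \<in> vectors ell2" "gradient c k \<in> vectors ell2"
    using r by (simp_all add: graph_def ell2_case_sum)
  let ?u = "laplacian c k"
  have u_eq: "?u x = - k x + (?u o\<^sub>0 + k o\<^sub>0)" for x
  proof -
    obtain v :: "'a \<Rightarrow> 'k" where v: "energy_kernel c o\<^sub>0 x = fmc_of v" "gradient c v \<in> vectors ell2"
      "\<And>u. gradient c u \<in> vectors ell2 \<Longrightarrow> iprod ell2 (gradient c v) (gradient c u) = u x - u o\<^sub>0"
      using energy_kernel_representative by blast
    have "v \<in> ?D"
      unfolding mem_Collect_eq v(1)[symmetric] by (intro fmc.span_base) simp
    then have "iprod ell2 (graph v) (graph k) = 0"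
      using orth[of "graph v"] r_eq by auto
    moreover have "laplacian c v \<in> vectors ell2"
      by (simp add: laplacian_dipole[OF v(2,3)] ell2_diff delta_in_ell2)
    ultimately have "(?u x - ?u o\<^sub>0) + (k x - k o\<^sub>0) = 0"
      by (simp add: graph_def ell2_iprod_case_sum v(2,3) kL ell2_iprod_laplacian_dipole[OF v(2,3)])
    then show ?thesis by (simp add: algebra_simps eq_neg_iff_add_eq_0)
  qed
  have "laplacian c ?u = laplacian c (0 - k)"
  proof (rule laplacian_add_const)
    show "?u x = (0 - k) x + (?u o\<^sub>0 + k o\<^sub>0)" for x
      unfolding u_eq[of x] by simp
  qed
  then have "laplacian c ?u = 0 - ?u" by (simp only: laplacian_diff laplacian_zero)
  then have "?u x + laplacian c ?u x = 0" for x by simp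
  with kL(1) have u0: "?u = 0" by (rule ell2_laplacian_eigenfunction_zero)
  have "gradient c k = gradient c 0"
  proof (rule gradient_add_const)
    show "k x = 0 x + k o\<^sub>0" for x
      using u_eq[of x] by (simp add: u0)
  qed
  then have "graph k = 0" using u0 by (simp add: graph_def fun_eq_iff split: sum.split)
  then have lim0: "(\<lambda>n. ip_norm ell2 (graph (w - g n))) \<longlonglongrightarrow> 0"
    using lim by (simp add: h r_eq)
  have dL: "laplacian c (w - g n) \<in> vectors ell2" "gradient c (w - g n) \<in> vectors ell2" for n
    using hL[of n] by (simp_all add: graph_def ell2_case_sum)
  have "(\<lambda>n. ip_norm ell2 (laplacian c (w - g n))) \<longlonglongrightarrow> 0"
    by (rule tendsto_sandwich[OF _ _ tendsto_const lim0])
       (simp_all add: graph_def ell2_norm_case_sum dL)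
  then have "(\<lambda>n. ip_norm ell2 (laplacian c (g n) - laplacian c w)) \<longlonglongrightarrow> 0"
    by (simp add: ell2_norm_minus_commute[of "laplacian c w"] laplacian_diff)
  moreover have "(\<lambda>n. ip_norm ell2 (gradient c (w - g n))) \<longlonglongrightarrow> 0"
    by (rule tendsto_sandwich[OF _ _ tendsto_const lim0])
       (simp_all add: graph_def ell2_norm_case_sum dL)
  then have "(\<lambda>n. ip_norm (energy_space c) (fmc_of (g n) - fmc_of w)) \<longlonglongrightarrow> 0"
    by (simp add: ell2_norm_minus_commute[of "gradient c w"] energy_space_norm gradient_diff
        flip: fmc_of_diff)
  moreover have "(fmc_of (g n), laplacian c (g n)) \<in> M_op c o\<^sub>0" for n
    using g(2) unfolding M_op_eq by blast
  ultimately show ?thesis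
    unfolding op_closure_def mem_Collect_eq prod.case mem_energy_space
    using w by (intro conjI exI[of _ "\<lambda>n. fmc_of (g n)"] exI[of _ "\<lambda>n. laplacian c (g n)"] allI)
      simp_all
qed

lemma closure_M:
  "op_closure (energy_space c) ell2 (M_op c o\<^sub>0 :: (_ \<times> ('a \<Rightarrow> 'k::rc_field)) set)
     = {(fmc_of w, laplacian c w) | w. gradient c w \<in> vectors ell2 \<and> laplacian c w \<in> vectors ell2}"
proof (rule equalityI; rule subrelI)
  fix w and u :: "'a \<Rightarrow> 'k"
  assume "(w, u) \<in> op_closure (energy_space c) ell2 (M_op c o\<^sub>0)"
  from closure_M_le[OF this]
  show "(w, u) \<in> {(fmc_of w, laplacian c w) | w.
    gradient c w \<in> vectors ell2 \<and> laplacian c w \<in> vectors ell2}" by blast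
next
  fix w and u :: "'a \<Rightarrow> 'k"
  assume "(w, u) \<in> {(fmc_of w, laplacian c w) | w.
    gradient c w \<in> vectors ell2 \<and> laplacian c w \<in> vectors ell2}"
  then obtain g where "w = fmc_of g" "u = laplacian c g"
    "gradient c g \<in> vectors ell2" "laplacian c g \<in> vectors ell2" by blast
  then show "(w, u) \<in> op_closure (energy_space c) ell2 (M_op c o\<^sub>0)"
    by (simp only: closure_M_ge)
qed

end

theorem corollary3p8:
  fixes c :: "'a \<Rightarrow> 'a \<Rightarrow> real" and o\<^sub>0 :: 'a
  assumes "network c"
  shows "op_closure ell2 (energy_space c) (J_op :: (('a \<Rightarrow> 'k::rc_field) \<times> ('a, 'k) fun_mod_const) set)
           = op_adjoint (energy_space c) ell2 (M_op c o\<^sub>0)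
       \<and> op_adjoint ell2 (energy_space c) (J_op :: (('a \<Rightarrow> 'k) \<times> ('a, 'k) fun_mod_const) set)
           = op_closure (energy_space c) ell2 (M_op c o\<^sub>0)"
  by (simp only: closure_J[OF assms] adjoint_M[OF assms] adjoint_J[OF assms] closure_M[OF assms])

end
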